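(* For any $\psi\in\mathrm{IA}_n(\mathbb Z/3)$ and any free factor system $\mathcal F$ in $F_n$, if $\mathcal F$ is $\psi$-periodic then $\mathcal F$ is fixed by $\psi$.
   Context: $F_n$ is the free group of rank $n$, and $\mathrm{IA}_n(\mathbb Z/3)$ is the kernel of the natural homomorphism $\mathrm{Out}(F_n)\to \mathrm{Aut}(H_1(F_n;\mathbb Z/3))$. For a subgroup $A< F_n$, $[A]$ is its conjugacy class. A free factor system is a finite (possibly empty) set $\{[A_1],\dots,[A_k]\}$, with each $A_i$ nontrivial, such that $F_n=A_1*\cdots*A_k*B$ for some (possibly trivial) subgroup $B$. $\mathrm{Out}(F_n)$ acts on the set of free factor systems. $\mathcal F$ is $\psi$-periodic if $\psi^k(\mathcal F)=\mathcal F$ for some $k\ge1$, and is fixed by $\psi$ if $\psi(\mathcal F)=\mathcal F$. *)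

theory Defs
  imports "HOL-Algebra.Bij" "HOL-Algebra.Generated_Groups" "HOL-Algebra.Group_Action"
begin

section \<open>Free groups\<close>

text \<open>A word over \<open>S\<close> is a list of letters \<open>(x, b)\<close> with \<open>x \<in> S\<close>; the letter \<open>(x, True)\<close>
  stands for the generator \<open>x\<close> and \<open>(x, False)\<close> for its inverse.\<close>

definition inv_letter :: "'a \<times> bool \<Rightarrow> 'a \<times> bool" where
  "inv_letter l = (fst l, \<not> snd l)"

definition reduced_word :: "('a \<times> bool) list \<Rightarrow> bool" where
  "reduced_word w \<longleftrightarrow> successively (\<lambda>l l'. l' \<noteq> inv_letter l) w"

fun push_letter :: "'a \<times> bool \<Rightarrow> ('a \<times> bool) list \<Rightarrow> ('a \<times> bool) list" where
  "push_letter l [] = [l]"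
| "push_letter l (l' # w) = (if l' = inv_letter l then w else l # l' # w)"

text \<open>For reduced \<open>u\<close> and \<open>v\<close>, \<open>foldr push_letter u v\<close> is the free reduction of \<open>u @ v\<close>.\<close>

definition free_group :: "'a set \<Rightarrow> ('a \<times> bool) list monoid" where
  "free_group S =
    \<lparr>carrier = {w. reduced_word w \<and> fst ` set w \<subseteq> S},
     mult = (\<lambda>u v. foldr push_letter u v),
     one = []\<rparr>"

lemma inv_letter_inv_letter [simp]: "inv_letter (inv_letter l) = l"
  by (simp add: inv_letter_def)

lemma fst_inv_letter [simp]: "fst (inv_letter l) = fst l"
  by (simp add: inv_letter_def)

lemma inv_letter_neq [simp]: "inv_letter l \<noteq> l" "l \<noteq> inv_letter l"
  by (auto simp: inv_letter_def prod_eq_iff)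

lemma reduced_word_Nil [simp]: "reduced_word []"
  by (simp add: reduced_word_def)

lemma reduced_word_ConsD: "reduced_word (l # w) \<Longrightarrow> reduced_word w"
  by (cases w) (auto simp: reduced_word_def)

lemma reduced_push_letter: "reduced_word w \<Longrightarrow> reduced_word (push_letter l w)"
  by (induction l w rule: push_letter.induct)
     (auto simp: reduced_word_def dest: reduced_word_ConsD[unfolded reduced_word_def])

lemma reduced_foldr_push: "reduced_word v \<Longrightarrow> reduced_word (foldr push_letter u v)"
  by (induction u) (auto simp: reduced_push_letter)

lemma push_push_inv:
  assumes "reduced_word w"
  shows "push_letter l (push_letter (inv_letter l) w) = w"
proof (cases w)
  case (Cons l' w')
  with assms show ?thesis by (cases w') (auto simp: reduced_word_def)
qed simp

lemma foldr_push_Nil: "reduced_word w \<Longrightarrow> foldr push_letter w [] = w"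
proof (induction w)
  case (Cons l w)
  then show ?case
    by (cases w) (auto simp: reduced_word_def)
qed simp

lemma foldr_push_push:
  assumes "reduced_word w"
  shows "foldr push_letter (push_letter l u) w = push_letter l (foldr push_letter u w)"
proof (cases u)
  case (Cons l' u')
  then show ?thesis
    using push_push_inv[OF reduced_foldr_push[OF assms], of l u'] by auto
qed simp

lemma foldr_push_assoc:
  assumes "reduced_word w"
  shows "foldr push_letter (foldr push_letter u v) w
    = foldr push_letter u (foldr push_letter v w)"
  by (induction u) (auto simp: foldr_push_push assms)

lemma set_push_letter: "fst ` set (push_letter l w) \<subseteq> insert (fst l) (fst ` set w)"
  by (induction l w rule: push_letter.induct) auto

lemma set_foldr_push: "fst ` set (foldr push_letter u v) \<subseteq> fst ` set u \<union> fst ` set v"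
proof (induction u)
  case (Cons l u)
  have "fst ` set (foldr push_letter (l # u) v) \<subseteq> insert (fst l) (fst ` set (foldr push_letter u v))"
    using set_push_letter[of l "foldr push_letter u v"] by simp
  also have "\<dots> \<subseteq> fst ` set (l # u) \<union> fst ` set v"
    using Cons.IH by auto
  finally show ?case .
qed simp

lemma foldr_push_inverse:
  "reduced_word w \<Longrightarrow> foldr push_letter (map inv_letter (rev u)) (foldr push_letter u w) = w"
proof (induction u arbitrary: w)
  case (Cons l u)
  then show ?case
    using push_push_inv[OF reduced_foldr_push[OF Cons.prems], of "inv_letter l" u] by simp
qed simp

lemma reduced_inverse_word: "reduced_word w \<Longrightarrow> reduced_word (map inv_letter (rev w))"
proof -
  assume "reduced_word w"
  then have "successively (\<lambda>l l'. l \<noteq> inv_letter l') (rev w)"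
    by (simp add: reduced_word_def)
  then show ?thesis
    unfolding reduced_word_def successively_map
    by (rule successively_mono) auto
qed

lemma group_free_group: "group (free_group S)"
proof (rule groupI)
  fix u v assume uv: "u \<in> carrier (free_group S)" "v \<in> carrier (free_group S)"
  then have "fst ` set u \<union> fst ` set v \<subseteq> S" by (simp add: free_group_def)
  with set_foldr_push[of u v] have "fst ` set (foldr push_letter u v) \<subseteq> S"
    by (rule subset_trans)
  then show "u \<otimes>\<^bsub>free_group S\<^esub> v \<in> carrier (free_group S)"
    using uv by (simp add: free_group_def reduced_foldr_push)
next
  fix u assume u: "u \<in> carrier (free_group S)"
  let ?v = "map inv_letter (rev u)"
  have "fst ` set ?v = fst ` set u" by (auto simp: image_image)
  then have "?v \<in> carrier (free_group S)"
    using u by (simp add: free_group_def reduced_inverse_word)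
  moreover have "?v \<otimes>\<^bsub>free_group S\<^esub> u = \<one>\<^bsub>free_group S\<^esub>"
    using u foldr_push_inverse[of "[]" u] by (simp add: free_group_def foldr_push_Nil)
  ultimately show "\<exists>v\<in>carrier (free_group S). v \<otimes>\<^bsub>free_group S\<^esub> u = \<one>\<^bsub>free_group S\<^esub>"
    by blast
qed (auto simp: free_group_def foldr_push_assoc foldr_push_Nil)

abbreviation Free :: "nat \<Rightarrow> (nat \<times> bool) list monoid" where
  "Free n \<equiv> free_group {..<n}"


section \<open>Outer automorphisms\<close>

definition inner_auto :: "('a, 'b) monoid_scheme \<Rightarrow> 'a \<Rightarrow> 'a \<Rightarrow> 'a" where
  "inner_auto G g = (\<lambda>x\<in>carrier G. g \<otimes>\<^bsub>G\<^esub> x \<otimes>\<^bsub>G\<^esub> inv\<^bsub>G\<^esub> g)"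

definition Inn :: "('a, 'b) monoid_scheme \<Rightarrow> ('a \<Rightarrow> 'a) set" where
  "Inn G = inner_auto G ` carrier G"

definition Out :: "('a, 'b) monoid_scheme \<Rightarrow> ('a \<Rightarrow> 'a) set monoid" where
  "Out G = AutoGroup G Mod Inn G"

lemma carrier_AutoGroup: "carrier (AutoGroup G) = auto G"
  by (simp add: AutoGroup_def)

lemma mult_AutoGroup:
  "f \<in> auto G \<Longrightarrow> g \<in> auto G \<Longrightarrow> f \<otimes>\<^bsub>AutoGroup G\<^esub> g = compose (carrier G) f g"
  by (simp add: AutoGroup_def BijGroup_def auto_def)

lemma one_AutoGroup: "\<one>\<^bsub>AutoGroup G\<^esub> = (\<lambda>x\<in>carrier G. x)"
  by (simp add: AutoGroup_def BijGroup_def)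

context group
begin

lemma inner_auto_in_auto: "g \<in> carrier G \<Longrightarrow> inner_auto G g \<in> auto G"
  unfolding auto_def inner_auto_def Bij_def
  using conjugation_is_bij[of g]
  by (auto simp: hom_def m_assoc inv_solve_left intro!: bij_betw_restrict_eq[THEN iffD2])

lemma inner_auto_hom: "inner_auto G \<in> hom G (AutoGroup G)"
proof (rule homI)
  fix g h assume gh: "g \<in> carrier G" "h \<in> carrier G"
  have "inner_auto G (g \<otimes> h) = compose (carrier G) (inner_auto G g) (inner_auto G h)"
    using gh by (auto simp: inner_auto_def compose_def fun_eq_iff m_assoc inv_mult_group)
  then show "inner_auto G (g \<otimes> h) = inner_auto G g \<otimes>\<^bsub>AutoGroup G\<^esub> inner_auto G h"
    using gh by (simp add: mult_AutoGroup inner_auto_in_auto)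
qed (simp add: carrier_AutoGroup inner_auto_in_auto)

lemma auto_closed: "f \<in> auto G \<Longrightarrow> x \<in> carrier G \<Longrightarrow> f x \<in> carrier G"
  by (auto simp: auto_def hom_def)

lemma auto_conj:
  assumes f: "f \<in> auto G" and g: "g \<in> carrier G"
  shows "f \<otimes>\<^bsub>AutoGroup G\<^esub> inner_auto G g = inner_auto G (f g) \<otimes>\<^bsub>AutoGroup G\<^esub> f"
proof -
  interpret f: group_hom G G f
    using f by unfold_locales (auto simp: auto_def)
  have "compose (carrier G) f (inner_auto G g) = compose (carrier G) (inner_auto G (f g)) f"
    using g by (auto simp: inner_auto_def compose_def fun_eq_iff)
  then show ?thesis
    using f g by (simp add: mult_AutoGroup inner_auto_in_auto)
qed

lemma Inn_normal: "Inn G \<lhd> AutoGroup G"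
proof -
  interpret A: group "AutoGroup G" by (rule AutoGroup)
  interpret c: group_hom G "AutoGroup G" "inner_auto G"
    by unfold_locales (rule inner_auto_hom)
  have "subgroup (Inn G) (AutoGroup G)"
    unfolding Inn_def by (rule c.img_is_subgroup)
  moreover have "f \<otimes>\<^bsub>AutoGroup G\<^esub> h \<otimes>\<^bsub>AutoGroup G\<^esub> inv\<^bsub>AutoGroup G\<^esub> f \<in> Inn G"
    if "f \<in> carrier (AutoGroup G)" "h \<in> Inn G" for f h
  proof -
    from that obtain g where g: "g \<in> carrier G" "h = inner_auto G g" by (auto simp: Inn_def)
    have f: "f \<in> auto G" using that by (simp add: carrier_AutoGroup)
    have c: "inner_auto G (f g) \<in> carrier (AutoGroup G)"
      using f g by (simp add: auto_closed)
    have "f \<otimes>\<^bsub>AutoGroup G\<^esub> h \<otimes>\<^bsub>AutoGroup G\<^esub> inv\<^bsub>AutoGroup G\<^esub> f = inner_auto G (f g)"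
      using auto_conj[OF f g(1)] g c that by (simp add: A.m_assoc)
    then show ?thesis using auto_closed[OF f g(1)] by (simp add: Inn_def)
  qed
  ultimately show ?thesis by (simp add: A.normal_inv_iff)
qed

lemma group_Out: "group (Out G)"
  unfolding Out_def by (rule normal.factorgroup_is_group[OF Inn_normal])

end


section \<open>Homology with coefficients in \<open>\<int>/m\<close>\<close>

definition Abelianization :: "('a, 'b) monoid_scheme \<Rightarrow> 'a set monoid" where
  "Abelianization G = G Mod (derived G (carrier G))"

definition power_subgroup :: "nat \<Rightarrow> ('a, 'b) monoid_scheme \<Rightarrow> 'a set" where
  "power_subgroup m A = (\<lambda>x. x [^]\<^bsub>A\<^esub> m) ` carrier A"

text \<open>\<open>H\<^sub>1(G; \<int>/m) = H\<^sub>1(G; \<int>) \<otimes> \<int>/m = A/mA\<close> for the abelianization \<open>A\<close> of \<open>G\<close>.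
  As \<open>A\<close> is written multiplicatively, \<open>mA\<close> is its set of \<open>m\<close>-th powers.\<close>

definition H1 :: "('a, 'b) monoid_scheme \<Rightarrow> nat \<Rightarrow> 'a set set monoid" where
  "H1 G m = Abelianization G Mod power_subgroup m (Abelianization G)"

definition quotient_map :: "('a, 'b) monoid_scheme \<Rightarrow> 'a set \<Rightarrow> ('a \<Rightarrow> 'a) \<Rightarrow> 'a set \<Rightarrow> 'a set" where
  "quotient_map G N f = (\<lambda>X\<in>carrier (G Mod N). f ` X)"

definition H1_map :: "('a, 'b) monoid_scheme \<Rightarrow> nat \<Rightarrow> ('a \<Rightarrow> 'a) \<Rightarrow> 'a set set \<Rightarrow> 'a set set" where
  "H1_map G m f =
    quotient_map (Abelianization G) (power_subgroup m (Abelianization G))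
      (quotient_map G (derived G (carrier G)) f)"

lemma quotient_map_auto:
  assumes "N \<lhd> G" "f \<in> auto G" "f ` N = N"
  shows "quotient_map G N f \<in> auto (G Mod N)"
    and "\<And>x. x \<in> carrier G \<Longrightarrow> quotient_map G N f (N #>\<^bsub>G\<^esub> x) = N #>\<^bsub>G\<^esub> f x"
proof -
  interpret N: normal N G by fact
  interpret f: group_hom G G f
    using assms by unfold_locales (auto simp: auto_def)
  have bij: "bij_betw f (carrier G) (carrier G)"
    using assms by (auto simp: auto_def Bij_def)
  have coset: "f ` (N #>\<^bsub>G\<^esub> x) = N #>\<^bsub>G\<^esub> f x" if "x \<in> carrier G" for x
  proof -
    have "f ` (N #>\<^bsub>G\<^esub> x) = (\<lambda>h. f (h \<otimes>\<^bsub>G\<^esub> x)) ` N"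
      by (auto simp: r_coset_def)
    also have "\<dots> = (\<lambda>h. f h \<otimes>\<^bsub>G\<^esub> f x) ` N"
      using that by (intro image_cong refl) simp
    also have "\<dots> = (\<lambda>h. h \<otimes>\<^bsub>G\<^esub> f x) ` (f ` N)" by (simp only: image_image)
    also have "\<dots> = N #>\<^bsub>G\<^esub> f x" unfolding assms(3) by (auto simp: r_coset_def)
    finally show ?thesis .
  qed
  show q: "quotient_map G N f (N #>\<^bsub>G\<^esub> x) = N #>\<^bsub>G\<^esub> f x" if "x \<in> carrier G" for x
    using that coset by (simp add: quotient_map_def carrier_FactGroup)
  have sub: "Y \<subseteq> carrier G" if "Y \<in> carrier (G Mod N)" for Y
    using that N.r_coset_subset_G[OF N.subset] by (auto simp: carrier_FactGroup)
  have "quotient_map G N f \<in> hom (G Mod N) (G Mod N)"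
  proof (rule homI)
    fix Y Z assume "Y \<in> carrier (G Mod N)" "Z \<in> carrier (G Mod N)"
    then obtain y z where yz: "y \<in> carrier G" "z \<in> carrier G" "Y = N #>\<^bsub>G\<^esub> y" "Z = N #>\<^bsub>G\<^esub> z"
      by (auto simp: carrier_FactGroup)
    then show "quotient_map G N f (Y \<otimes>\<^bsub>G Mod N\<^esub> Z)
        = quotient_map G N f Y \<otimes>\<^bsub>G Mod N\<^esub> quotient_map G N f Z"
      by (simp add: N.rcos_sum q)
  qed (auto simp: carrier_FactGroup q)
  moreover have "bij_betw (quotient_map G N f) (carrier (G Mod N)) (carrier (G Mod N))"
  proof (rule bij_betw_imageI)
    show "inj_on (quotient_map G N f) (carrier (G Mod N))"
    proof (rule inj_onI)
      fix Y Z assume YZ: "Y \<in> carrier (G Mod N)" "Z \<in> carrier (G Mod N)"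
        "quotient_map G N f Y = quotient_map G N f Z"
      then have "f ` Y = f ` Z" by (simp add: quotient_map_def)
      with bij sub[OF YZ(1)] sub[OF YZ(2)] show "Y = Z"
        using inj_on_image_eq_iff[of f "carrier G" Y Z] by (simp add: bij_betw_def)
    qed
    have "quotient_map G N f ` carrier (G Mod N) = (\<lambda>x. N #>\<^bsub>G\<^esub> x) ` (f ` carrier G)"
      by (auto simp: carrier_FactGroup q image_image)
    also have "\<dots> = carrier (G Mod N)"
      using bij by (simp add: bij_betw_def carrier_FactGroup)
    finally show "quotient_map G N f ` carrier (G Mod N) = carrier (G Mod N)" .
  qed
  ultimately show "quotient_map G N f \<in> auto (G Mod N)"
    by (simp add: auto_def Bij_def) (simp add: quotient_map_def)
qed

lemma quotient_map_compose:
  assumes "N \<lhd> G" "f \<in> auto G" "f ` N = N" "g \<in> auto G" "g ` N = N"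
  shows "quotient_map G N (compose (carrier G) f g)
    = compose (carrier (G Mod N)) (quotient_map G N f) (quotient_map G N g)"
proof
  fix Y
  interpret N: normal N G by fact
  show "quotient_map G N (compose (carrier G) f g) Y
    = compose (carrier (G Mod N)) (quotient_map G N f) (quotient_map G N g) Y"
  proof (cases "Y \<in> carrier (G Mod N)")
    case True
    then have "Y \<subseteq> carrier G"
      using N.r_coset_subset_G[OF N.subset] by (auto simp: carrier_FactGroup)
    then have "compose (carrier G) f g ` Y = f ` (g ` Y)"
      by (auto simp: compose_def image_image intro!: image_cong)
    moreover have "quotient_map G N g Y \<in> carrier (G Mod N)"
      using quotient_map_auto(1)[OF assms(1,4,5)] True by (auto simp: auto_def hom_def)
    ultimately show ?thesis using True by (simp add: quotient_map_def compose_def)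
  qed (simp add: quotient_map_def compose_def)
qed

context group
begin

lemma auto_derived:
  assumes "f \<in> auto G"
  shows "f ` derived G (carrier G) = derived G (carrier G)"
proof -
  interpret f: group_hom G G f
    using assms by unfold_locales (auto simp: auto_def)
  have "f ` carrier G = carrier G"
    using assms by (auto simp: auto_def Bij_def bij_betw_def)
  then show ?thesis using f.derived_img[of "carrier G"] by simp
qed

lemma comm_group_Abelianization: "comm_group (Abelianization G)"
  unfolding Abelianization_def
proof (rule group.group_comm_groupI[OF normal.factorgroup_is_group[OF derived_self_is_normal]])
  let ?D = "derived G (carrier G)"
  interpret D: normal ?D G by (rule derived_self_is_normal)
  fix Y Z assume "Y \<in> carrier (G Mod ?D)" "Z \<in> carrier (G Mod ?D)"
  then obtain y z where yz: "y \<in> carrier G" "z \<in> carrier G" "Y = ?D #> y" "Z = ?D #> z"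
    by (auto simp: carrier_FactGroup)
  have "y \<otimes> z \<otimes> inv y \<otimes> inv z \<in> ?D"
    unfolding derived_def using yz by (intro generate.incl) auto
  moreover have "(y \<otimes> z) = (y \<otimes> z \<otimes> inv y \<otimes> inv z) \<otimes> (z \<otimes> y)"
    using yz by (simp add: m_assoc) (simp flip: m_assoc)
  ultimately have "y \<otimes> z \<in> ?D #> (z \<otimes> y)"
    unfolding r_coset_def by blast
  then have "?D #> (z \<otimes> y) = ?D #> (y \<otimes> z)"
    using yz by (intro repr_independence D.subgroup_axioms) auto
  then show "Y \<otimes>\<^bsub>G Mod ?D\<^esub> Z = Z \<otimes>\<^bsub>G Mod ?D\<^esub> Y"
    using yz by (simp add: D.rcos_sum)
qed

end

lemma (in comm_group) power_subgroup_normal: "power_subgroup m G \<lhd> G"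
proof (rule subgroup_imp_normal)
  interpret p: group_hom G G "\<lambda>x. x [^] m"
    by unfold_locales (auto simp: hom_def nat_pow_distrib)
  show "subgroup (power_subgroup m G) G"
    unfolding power_subgroup_def by (rule p.img_is_subgroup)
qed

lemma (in group) auto_power_subgroup:
  assumes "f \<in> auto G"
  shows "f ` power_subgroup m G = power_subgroup m G"
proof -
  interpret f: group_hom G G f
    using assms by unfold_locales (auto simp: auto_def)
  have "f ` carrier G = carrier G"
    using assms by (auto simp: auto_def Bij_def bij_betw_def)
  moreover have "f ` power_subgroup m G = (\<lambda>x. x [^] m) ` (f ` carrier G)"
    by (auto simp: power_subgroup_def image_image f.hom_nat_pow intro!: image_cong)
  ultimately show ?thesis by (simp add: power_subgroup_def)
qed

context group
begin

lemma group_H1: "group (H1 G m)"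
  unfolding H1_def
  by (intro normal.factorgroup_is_group comm_group.power_subgroup_normal comm_group_Abelianization)

lemma H1_map_hom: "H1_map G m \<in> hom (AutoGroup G) (AutoGroup (H1 G m))"
proof -
  interpret A: comm_group "Abelianization G" by (rule comm_group_Abelianization)
  let ?q = "quotient_map G (derived G (carrier G))"
  let ?P = "power_subgroup m (Abelianization G)"
  have q: "?q f \<in> auto (Abelianization G)" if "f \<in> auto G" for f
    unfolding Abelianization_def
    using that by (intro quotient_map_auto derived_self_is_normal auto_derived)
  have H: "H1_map G m f \<in> auto (H1 G m)" if "f \<in> auto G" for f
    unfolding H1_map_def H1_def
    using that by (intro quotient_map_auto A.power_subgroup_normal A.auto_power_subgroup q)
  show ?thesis
  proof (rule homI)
    fix f g assume "f \<in> carrier (AutoGroup G)" "g \<in> carrier (AutoGroup G)"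
    then have fg: "f \<in> auto G" "g \<in> auto G" by (simp_all add: carrier_AutoGroup)
    have "?q (compose (carrier G) f g) = compose (carrier (Abelianization G)) (?q f) (?q g)"
      unfolding Abelianization_def
      using fg by (intro quotient_map_compose derived_self_is_normal auto_derived)
    then have "H1_map G m (compose (carrier G) f g)
        = compose (carrier (H1 G m)) (H1_map G m f) (H1_map G m g)"
      unfolding H1_map_def H1_def
      using quotient_map_compose[OF A.power_subgroup_normal q[OF fg(1)] A.auto_power_subgroup
          q[OF fg(2)] A.auto_power_subgroup] fg q by simp
    then show "H1_map G m (f \<otimes>\<^bsub>AutoGroup G\<^esub> g)
        = H1_map G m f \<otimes>\<^bsub>AutoGroup (H1 G m)\<^esub> H1_map G m g"
      using fg H by (simp add: mult_AutoGroup)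
  qed (simp add: carrier_AutoGroup H)
qed

lemma H1_map_inner:
  assumes g: "g \<in> carrier G"
  shows "H1_map G m (inner_auto G g) = \<one>\<^bsub>AutoGroup (H1 G m)\<^esub>"
proof -
  let ?D = "derived G (carrier G)"
  interpret D: normal ?D G by (rule derived_self_is_normal)
  interpret A: comm_group "Abelianization G" by (rule comm_group_Abelianization)
  interpret P: normal "power_subgroup m (Abelianization G)" "Abelianization G"
    by (rule A.power_subgroup_normal)
  have i: "inner_auto G g \<in> auto G" using g by (rule inner_auto_in_auto)
  have "quotient_map G ?D (inner_auto G g) Y = Y" if "Y \<in> carrier (Abelianization G)" for Y
  proof -
    from that obtain x where x: "x \<in> carrier G" "Y = ?D #> x"
      by (auto simp: Abelianization_def carrier_FactGroup)
    have "g \<otimes> x \<otimes> inv g \<otimes> inv x \<in> ?D"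
      unfolding derived_def using x g by (intro generate.incl) auto
    moreover have "g \<otimes> x \<otimes> inv g = (g \<otimes> x \<otimes> inv g \<otimes> inv x) \<otimes> x"
      using x g by (simp add: m_assoc)
    ultimately have "g \<otimes> x \<otimes> inv g \<in> ?D #> x"
      unfolding r_coset_def by blast
    then have "?D #> x = ?D #> (g \<otimes> x \<otimes> inv g)"
      using x by (intro repr_independence D.subgroup_axioms) auto
    then show ?thesis
      using quotient_map_auto(2)[OF derived_self_is_normal i auto_derived[OF i] x(1)] x
      by (simp add: inner_auto_def)
  qed
  moreover have "Y \<subseteq> carrier (Abelianization G)" if "Y \<in> carrier (H1 G m)" for Y
    using that A.r_coset_subset_G[OF P.subset] by (auto simp: H1_def carrier_FactGroup)
  ultimately have "quotient_map G ?D (inner_auto G g) ` Y = Y" if "Y \<in> carrier (H1 G m)" for Y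
    using that by (metis (no_types, lifting) image_cong image_ident subsetD)
  then have "H1_map G m (inner_auto G g) = (\<lambda>Y\<in>carrier (H1 G m). Y)"
    unfolding H1_map_def quotient_map_def[of "Abelianization G"] H1_def
    by (intro restrict_ext)
  then show ?thesis by (simp add: one_AutoGroup)
qed

end

text \<open>All representatives of an outer automorphism induce the same map on homology
  (\<open>Out_H1_coset\<close> below), so \<open>the_elem\<close> picks the common value.\<close>

definition Out_H1 :: "('a, 'b) monoid_scheme \<Rightarrow> nat \<Rightarrow> ('a \<Rightarrow> 'a) set \<Rightarrow> 'a set set \<Rightarrow> 'a set set" where
  "Out_H1 G m \<Psi> = the_elem (H1_map G m ` \<Psi>)"

definition IA :: "('a, 'b) monoid_scheme \<Rightarrow> nat \<Rightarrow> ('a \<Rightarrow> 'a) set set" where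
  "IA G m = kernel (Out G) (AutoGroup (H1 G m)) (Out_H1 G m)"

context group
begin

lemma Out_H1_coset:
  assumes f: "f \<in> auto G"
  shows "Out_H1 G m (Inn G #>\<^bsub>AutoGroup G\<^esub> f) = H1_map G m f"
proof -
  interpret H: group_hom "AutoGroup G" "AutoGroup (H1 G m)" "H1_map G m"
    by (intro group_hom.intro group_hom_axioms.intro AutoGroup H1_map_hom
        group.AutoGroup group_H1)
  have f': "f \<in> carrier (AutoGroup G)" using f by (simp add: carrier_AutoGroup)
  have "H1_map G m (h \<otimes>\<^bsub>AutoGroup G\<^esub> f) = H1_map G m f" if "h \<in> Inn G" for h
  proof -
    from that obtain g where g: "g \<in> carrier G" "h = inner_auto G g" by (auto simp: Inn_def)
    then have "h \<in> carrier (AutoGroup G)" by (simp add: carrier_AutoGroup inner_auto_in_auto)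
    with f' g show ?thesis by (simp add: H1_map_inner)
  qed
  moreover have "Inn G \<noteq> {}" by (auto simp: Inn_def)
  ultimately have "(\<lambda>h. H1_map G m (h \<otimes>\<^bsub>AutoGroup G\<^esub> f)) ` Inn G = {H1_map G m f}"
    by (simp add: image_constant_conv cong: image_cong)
  moreover have "Inn G #>\<^bsub>AutoGroup G\<^esub> f = (\<lambda>h. h \<otimes>\<^bsub>AutoGroup G\<^esub> f) ` Inn G"
    by (auto simp only: r_coset_def)
  ultimately have "H1_map G m ` (Inn G #>\<^bsub>AutoGroup G\<^esub> f) = {H1_map G m f}"
    by (simp add: image_image)
  then show ?thesis by (simp add: Out_H1_def)
qed

lemma Out_H1_hom: "Out_H1 G m \<in> hom (Out G) (AutoGroup (H1 G m))"
proof (rule homI)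
  interpret I: normal "Inn G" "AutoGroup G" by (rule Inn_normal)
  have H: "H1_map G m f \<in> carrier (AutoGroup (H1 G m))" if "f \<in> auto G" for f
    using H1_map_hom that by (auto simp: hom_def carrier_AutoGroup)
  show "Out_H1 G m Y \<in> carrier (AutoGroup (H1 G m))" if "Y \<in> carrier (Out G)" for Y
    using that H by (auto simp: Out_def carrier_FactGroup carrier_AutoGroup[of G] Out_H1_coset)
  fix Y Z assume "Y \<in> carrier (Out G)" "Z \<in> carrier (Out G)"
  then obtain f g where fg: "f \<in> auto G" "g \<in> auto G"
    "Y = Inn G #>\<^bsub>AutoGroup G\<^esub> f" "Z = Inn G #>\<^bsub>AutoGroup G\<^esub> g"
    by (auto simp: Out_def carrier_FactGroup carrier_AutoGroup)
  have "f \<otimes>\<^bsub>AutoGroup G\<^esub> g \<in> auto G"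
    using fg I.m_closed by (simp add: carrier_AutoGroup)
  moreover have "Y \<otimes>\<^bsub>Out G\<^esub> Z = Inn G #>\<^bsub>AutoGroup G\<^esub> (f \<otimes>\<^bsub>AutoGroup G\<^esub> g)"
    using fg by (simp add: Out_def I.rcos_sum carrier_AutoGroup)
  ultimately show "Out_H1 G m (Y \<otimes>\<^bsub>Out G\<^esub> Z)
      = Out_H1 G m Y \<otimes>\<^bsub>AutoGroup (H1 G m)\<^esub> Out_H1 G m Z"
    using fg H1_map_hom by (simp add: Out_H1_coset hom_def carrier_AutoGroup)
qed

end


section \<open>Free factor systems\<close>

text \<open>The free product of the subgroups \<open>H i\<close>, \<open>i \<in> I\<close>, is realised on the set of its normal
  forms: sequences of nontrivial elements in which neighbours come from different factors.
  \<open>G\<close> is the internal free product of the \<open>H i\<close> if the canonical map to \<open>G\<close>, which multiplies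
  the syllables of a normal form, is bijective.\<close>

definition free_product_words ::
  "('a, 'b) monoid_scheme \<Rightarrow> 'i set \<Rightarrow> ('i \<Rightarrow> 'a set) \<Rightarrow> ('i \<times> 'a) list set" where
  "free_product_words G I H =
    {w. (\<forall>(i, a)\<in>set w. i \<in> I \<and> a \<in> H i \<and> a \<noteq> \<one>\<^bsub>G\<^esub>) \<and>
        successively (\<lambda>s t. fst s \<noteq> fst t) w}"

definition word_product :: "('a, 'b) monoid_scheme \<Rightarrow> ('i \<times> 'a) list \<Rightarrow> 'a" where
  "word_product G w = foldr (\<lambda>(i, a) x. a \<otimes>\<^bsub>G\<^esub> x) w \<one>\<^bsub>G\<^esub>"

definition internal_free_product ::
  "('a, 'b) monoid_scheme \<Rightarrow> 'i set \<Rightarrow> ('i \<Rightarrow> 'a set) \<Rightarrow> bool" where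
  "internal_free_product G I H \<longleftrightarrow>
    (\<forall>i\<in>I. subgroup (H i) G) \<and>
    bij_betw (word_product G) (free_product_words G I H) (carrier G)"

definition conj_class :: "('a, 'b) monoid_scheme \<Rightarrow> 'a set \<Rightarrow> 'a set set" where
  "conj_class G A = {g <#\<^bsub>G\<^esub> A #>\<^bsub>G\<^esub> inv\<^bsub>G\<^esub> g | g. g \<in> carrier G}"

text \<open>The factors are \<open>A 0, \<dots>, A (k - 1)\<close>, with the cofactor \<open>B\<close> placed at index \<open>k\<close>.\<close>

definition free_factor_system :: "('a, 'b) monoid_scheme \<Rightarrow> 'a set set set \<Rightarrow> bool" where
  "free_factor_system G \<F> \<longleftrightarrow>
    (\<exists>(k::nat) A B. \<F> = (\<lambda>i. conj_class G (A i)) ` {..<k} \<and>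
      (\<forall>i<k. A i \<noteq> {\<one>\<^bsub>G\<^esub>}) \<and>
      internal_free_product G {..k} (A(k := B)))"

text \<open>\<open>Out G\<close> acts on conjugacy classes of subgroups by \<open>[A] \<mapsto> [f(A)]\<close> for any
  representative \<open>f\<close>; see \<open>Out_conj_class_coset\<close> below.\<close>

definition Out_conj_class :: "('a \<Rightarrow> 'a) set \<Rightarrow> 'a set set \<Rightarrow> 'a set set" where
  "Out_conj_class \<Psi> c = {f ` A | f A. f \<in> \<Psi> \<and> A \<in> c}"

lemma (in group) Out_conj_class_coset:
  assumes f: "f \<in> auto G" and A: "A \<subseteq> carrier G"
  shows "Out_conj_class (Inn G #>\<^bsub>AutoGroup G\<^esub> f) (conj_class G A) = conj_class G (f ` A)"
proof -
  interpret f: group_hom G G f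
    using f by unfold_locales (auto simp: auto_def)
  have conj: "g <# B #> inv g = (\<lambda>x. g \<otimes> x \<otimes> inv g) ` B" for g B
    unfolding l_coset_def r_coset_def by blast
  have *: "(inner_auto G g \<otimes>\<^bsub>AutoGroup G\<^esub> f) ` (h <# A #> inv h)
      = (g \<otimes> f h) <# (f ` A) #> inv (g \<otimes> f h)"
    if "g \<in> carrier G" "h \<in> carrier G" for g h
    unfolding conj mult_AutoGroup[OF inner_auto_in_auto[OF that(1)] f] image_image
  proof (intro image_cong refl)
    fix x assume "x \<in> A"
    with A have "x \<in> carrier G" by blast
    with that show "compose (carrier G) (inner_auto G g) f (h \<otimes> x \<otimes> inv h)
        = g \<otimes> f h \<otimes> f x \<otimes> inv (g \<otimes> f h)"
      by (simp add: compose_def inner_auto_def m_assoc inv_mult_group)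
  qed
  have "Out_conj_class (Inn G #>\<^bsub>AutoGroup G\<^esub> f) (conj_class G A)
      = {(g \<otimes> f h) <# (f ` A) #> inv (g \<otimes> f h) | g h. g \<in> carrier G \<and> h \<in> carrier G}"
    (is "?L = ?M")
  proof
    show "?L \<subseteq> ?M"
    proof
      fix Y assume "Y \<in> ?L"
      then obtain g h where gh: "g \<in> carrier G" "h \<in> carrier G"
        "Y = (inner_auto G g \<otimes>\<^bsub>AutoGroup G\<^esub> f) ` (h <# A #> inv h)"
        unfolding Out_conj_class_def conj_class_def Inn_def r_coset_def[of "AutoGroup G"] by blast
      show "Y \<in> ?M" unfolding gh(3) *[OF gh(1,2)] using gh(1,2) by blast
    qed
    show "?M \<subseteq> ?L"
    proof
      fix Y assume "Y \<in> ?M"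
      then obtain g h where gh: "g \<in> carrier G" "h \<in> carrier G"
        "Y = (inner_auto G g \<otimes>\<^bsub>AutoGroup G\<^esub> f) ` (h <# A #> inv h)"
        using * by blast
      then show "Y \<in> ?L"
        unfolding Out_conj_class_def conj_class_def Inn_def r_coset_def[of "AutoGroup G"] by blast
    qed
  qed
  also have "\<dots> = conj_class G (f ` A)"
  proof
    show "?M \<subseteq> conj_class G (f ` A)"
    proof
      fix Y assume "Y \<in> ?M"
      then obtain g h where gh: "g \<in> carrier G" "h \<in> carrier G"
        "Y = (g \<otimes> f h) <# (f ` A) #> inv (g \<otimes> f h)" by blast
      moreover from gh have "g \<otimes> f h \<in> carrier G" by simp
      ultimately show "Y \<in> conj_class G (f ` A)" unfolding conj_class_def by blast
    qed
    show "conj_class G (f ` A) \<subseteq> ?M"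
    proof
      fix B assume "B \<in> conj_class G (f ` A)"
      then obtain g where "g \<in> carrier G" "B = g <# (f ` A) #> inv g"
        by (auto simp: conj_class_def)
      then have "B = (g \<otimes> f \<one>) <# (f ` A) #> inv (g \<otimes> f \<one>)" by simp
      then show "B \<in> ?M" using \<open>g \<in> carrier G\<close> one_closed by blast
    qed
  qed
  finally show ?thesis .
qed

definition Out_ffs :: "('a \<Rightarrow> 'a) set \<Rightarrow> 'a set set set \<Rightarrow> 'a set set set" where
  "Out_ffs \<Psi> \<F> = Out_conj_class \<Psi> ` \<F>"

definition ffs_periodic :: "('a, 'b) monoid_scheme \<Rightarrow> ('a \<Rightarrow> 'a) set \<Rightarrow> 'a set set set \<Rightarrow> bool" where
  "ffs_periodic G \<Psi> \<F> \<longleftrightarrow> (\<exists>k\<ge>1. Out_ffs (\<Psi> [^]\<^bsub>Out G\<^esub> (k::nat)) \<F> = \<F>)"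

definition ffs_fixed :: "('a \<Rightarrow> 'a) set \<Rightarrow> 'a set set set \<Rightarrow> bool" where
  "ffs_fixed \<Psi> \<F> \<longleftrightarrow> Out_ffs \<Psi> \<F> = \<F>"

end

theory Submission
  imports Defs "HOL-Computational_Algebra.Polynomial" "HOL-Library.Function_Algebras"
begin

text \<open>
  Let \<open>\<Phi>\<close> be an automorphism of \<open>G = F\<^sub>n\<close> that represents \<open>\<psi>\<close>.  A power of \<open>\<psi>\<close> permutes the
  finitely many classes of the system, so each of them is \<open>\<psi>\<close>-periodic on its own, and it suffices to
  treat a single factor: if \<open>G = A * B\<close> and \<open>\<Phi>\<^sup>m(A)\<close> is conjugate to \<open>A\<close>, then \<open>\<Phi>(A)\<close> is conjugate
  to \<open>A\<close>.

  The proof transports an argument of Minkowski from matrices to functions.  If an endomorphism \<open>M\<close>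
  of a lattice is the identity modulo \<open>3\<close> and \<open>M\<^sup>m\<close> preserves a sublattice that is pure and
  \<open>3\<close>-adically closed, then so does \<open>M\<close> (\<open>M_V_if_M_pow_V\<close>).  The lattice used here consists of
  the class functions \<open>f\<close> on \<open>G\<close>, with values in a polynomial ring over the integers, whose
  \<open>j\<close>-fold differences are divisible by \<open>3\<^sup>j\<close> for every \<open>j\<close>.  In this lattice \<open>f \<circ> \<Phi>\<close> and \<open>f\<close> agree
  modulo \<open>3\<close>, because \<open>\<Phi>(x)\<close> differs from \<open>x\<close> by commutators and a cube (\<open>filtered_pullback\<close>):
  commutators produce second differences, and cubes produce three times a first difference up to
  higher ones.  The functions that vanish on \<open>A\<close> form such a sublattice, preserved by the \<open>m\<close>-th
  power of \<open>f \<mapsto> f \<circ> \<Phi>\<close> since class functions do not see conjugation.  Hence every such \<open>f\<close>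
  vanishes on \<open>\<Phi>(A)\<close> (\<open>class_function_vanishes_on_image\<close>).

  Enough functions of this kind come from characters: the trace of a representation by matrices
  congruent to \<open>1\<close> modulo \<open>3\<close> lies in the lattice (\<open>trace_filtered\<close>).  The starting point is a
  representation \<open>\<sigma>\<close> of \<open>F\<^sub>n\<close> in \<open>SL\<^sub>2(\<int>[t])\<close>, congruent to \<open>1\<close> modulo \<open>3\<close>, for which no nontrivial
  element has trace \<open>2\<close> or lower left entry \<open>0\<close>.  On \<open>A * B\<close> consider the representation \<open>\<rho>\<close> that is
  \<open>\<sigma>\<close> on \<open>A\<close> and the conjugate of \<open>\<sigma>\<close> by the upper unitriangular matrix with entry \<open>u\<close> on \<open>B\<close>.
  On a mixed element \<open>a\<^sub>1 b\<^sub>1 \<cdots> a\<^sub>s b\<^sub>s\<close> its trace is a polynomial in \<open>u\<close> of degree \<open>2 s\<close>, so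
  \<open>tr \<rho> - tr \<sigma>\<close> vanishes on \<open>A\<close> and at no mixed element (\<open>detect_mixed\<close>).  The representation that
  is trivial on \<open>A\<close> and \<open>\<sigma>\<close> on \<open>B\<close> similarly detects the nontrivial elements of \<open>B\<close>
  (\<open>detect_B\<close>).

  Each element of \<open>A * B\<close> is conjugate to an element of \<open>A\<close>, to an element of \<open>B\<close>, or to a mixed
  element, so the elements of \<open>\<Phi>(A)\<close> are all conjugate into \<open>A\<close>.  One conjugator works for all of
  them: after a conjugation some \<open>c = \<Phi>(x) \<noteq> 1\<close> lies in \<open>A\<close>, and if \<open>\<Phi>(y) \<notin> A\<close>, then \<open>\<Phi>(y)\<close> or
  \<open>c \<Phi>(y) = \<Phi>(x y)\<close> is conjugate to a mixed element.  Thus \<open>\<Phi>(A)\<close> lies in a conjugate of \<open>A\<close>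
  (\<open>image_conjugate_into_factor\<close>), and it fills this conjugate because \<open>\<Phi>\<^sup>m(A)\<close> is a full conjugate
  and \<open>u A u\<^sup>-\<^sup>1 \<subseteq> A\<close> forces \<open>u \<in> A\<close> (\<open>conj_class_image_factor\<close>).
\<close>

section \<open>Divisibility by powers of three\<close>

text \<open>The class functions take values in a ring of this kind.  A congruence modulo all powers of \<open>3\<close> is
  an equation there, and quotients by \<open>3\<close> are unique.\<close>

class three_separated = idom_divide +
  assumes three_nonzero: "3 \<noteq> 0"
    and three_separated: "(\<And>k. 3 ^ k dvd x) \<Longrightarrow> x = 0"

instance int :: three_separated
proof
  fix x :: int
  assume d: "3 ^ k dvd x" for k :: nat
  show "x = 0"
  proof (rule ccontr)
    assume "x \<noteq> 0"
    with d[of "nat \<bar>x\<bar>"] have "3 ^ nat \<bar>x\<bar> \<le> \<bar>x\<bar>"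
      using dvd_imp_le_int[of x "3 ^ nat \<bar>x\<bar>"] by simp
    moreover have "int (nat \<bar>x\<bar>) < int (3 ^ nat \<bar>x\<bar>)"
      by (simp only: of_nat_less_iff) (rule less_exp[THEN less_le_trans], simp add: power_mono)
    ultimately show False by simp
  qed
qed simp

instance poly :: (three_separated) three_separated
proof
  have three: "(3::'a poly) = [:3:]"
    by (rule numeral_poly)
  show "(3::'a poly) \<noteq> 0"
    using three_nonzero[where ?'a = 'a] by (simp add: three)
  fix p :: "'a poly"
  assume "3 ^ k dvd p" for k :: nat
  then have "[:3 ^ k:] dvd p" for k :: nat
    by (simp add: three poly_const_pow)
  then have "coeff p i = 0" for i
    by (intro three_separated) (simp add: const_poly_dvd_iff)
  then show "p = 0" by (simp add: poly_eq_iff)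
qed

section \<open>Minkowski's argument for a sublattice\<close>

text \<open>An additive group \<open>L\<close>, placed inside a commutative ring so that multiplication by \<open>3\<close> is
  available, with a subgroup \<open>V\<close> that is pure at \<open>3\<close> and closed in the \<open>3\<close>-adic topology of
  \<open>L\<close>.  Closedness makes up for the missing finiteness of the rank.\<close>

locale lattice_pair =
  fixes L V :: "'a::comm_ring_1 set"
  assumes L_zero: "0 \<in> L"
    and L_add: "x \<in> L \<Longrightarrow> y \<in> L \<Longrightarrow> x + y \<in> L"
    and L_uminus: "x \<in> L \<Longrightarrow> - x \<in> L"
    and V_sub: "V \<subseteq> L"
    and V_zero: "0 \<in> V"
    and V_add: "x \<in> V \<Longrightarrow> y \<in> V \<Longrightarrow> x + y \<in> V"
    and V_uminus: "x \<in> V \<Longrightarrow> - x \<in> V"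
    and V_pure: "x \<in> L \<Longrightarrow> 3 * x \<in> V \<Longrightarrow> x \<in> V"
    and V_closed: "x \<in> L \<Longrightarrow> (\<And>k. \<exists>v\<in>V. \<exists>l\<in>L. x = v + 3 ^ k * l) \<Longrightarrow> x \<in> V"

text \<open>The endomorphism \<open>M = 1 + 3 N\<close> of \<open>L\<close> is given through \<open>N\<close>, because divisions by \<open>3\<close> are what
  the argument consists of.\<close>

locale minkowski = lattice_pair L V for L V :: "'a::comm_ring_1 set" +
  fixes N :: "'a \<Rightarrow> 'a"
  assumes N_closed: "x \<in> L \<Longrightarrow> N x \<in> L"
    and N_add: "x \<in> L \<Longrightarrow> y \<in> L \<Longrightarrow> N (x + y) = N x + N y"
begin

definition M :: "'a \<Rightarrow> 'a" where "M x = x + 3 * N x"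

definition W :: "nat \<Rightarrow> 'a set" where "W k = {v + 3 ^ k * l | v l. v \<in> V \<and> l \<in> L}"

lemma three_times: "3 * x = x + x + (x::'a)"
proof -
  have "3 * x = (1 + 1 + 1) * x" by simp
  also have "\<dots> = x + x + x" by (simp only: distrib_right mult_1)
  finally show ?thesis .
qed

lemma L_three: "x \<in> L \<Longrightarrow> 3 * x \<in> L"
  by (simp only: three_times L_add)

lemma L_pow: "x \<in> L \<Longrightarrow> 3 ^ k * x \<in> L"
  by (induction k) (simp_all add: L_three mult.assoc)

lemma N_three: "x \<in> L \<Longrightarrow> N (3 * x) = 3 * N x"
  by (simp only: three_times L_add N_add)

lemma N_pow: "x \<in> L \<Longrightarrow> N (3 ^ k * x) = 3 ^ k * N x"
  by (induction k) (simp_all add: N_three L_pow mult.assoc)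

lemma L_of_nat: "x \<in> L \<Longrightarrow> of_nat q * x \<in> L"
  by (induction q) (simp_all add: L_zero L_add algebra_simps)

lemma N_of_nat: "x \<in> L \<Longrightarrow> N (of_nat q * x) = of_nat q * N x"
proof (induction q)
  case 0
  show ?case using N_add[OF L_zero L_zero] by simp
next
  case (Suc q)
  then have "N (x + of_nat q * x) = N x + of_nat q * N x" by (simp add: N_add L_of_nat)
  then show ?case by (simp add: distrib_right)
qed

lemma V_three: "x \<in> V \<Longrightarrow> 3 * x \<in> V"
  by (simp only: three_times V_add)

lemma W_sub: "W k \<subseteq> L"
  using V_sub by (auto simp: W_def intro!: L_add L_pow)

lemma W_zero: "W 0 = L"
proof
  show "L \<subseteq> W 0"
  proof
    fix x assume "x \<in> L"
    then have "x = 0 + 3 ^ 0 * x \<and> 0 \<in> V \<and> x \<in> L" by (simp add: V_zero)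
    then show "x \<in> W 0" unfolding W_def by blast
  qed
qed (rule W_sub)

lemma V_sub_W: "v \<in> V \<Longrightarrow> v \<in> W k"
proof -
  assume "v \<in> V"
  then have "v = v + 3 ^ k * 0 \<and> v \<in> V \<and> 0 \<in> L" by (simp add: L_zero)
  then show ?thesis unfolding W_def by blast
qed

lemma W_add: "x \<in> W k \<Longrightarrow> y \<in> W k \<Longrightarrow> x + y \<in> W k"
proof -
  assume "x \<in> W k" "y \<in> W k"
  then obtain v l v' l' where "v \<in> V" "l \<in> L" "v' \<in> V" "l' \<in> L"
    "x = v + 3 ^ k * l" "y = v' + 3 ^ k * l'"
    unfolding W_def by blast
  moreover from this have "x + y = (v + v') + 3 ^ k * (l + l')" by (simp add: algebra_simps)
  ultimately show ?thesis unfolding W_def using V_add L_add by blast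
qed

lemma W_uminus: "x \<in> W k \<Longrightarrow> - x \<in> W k"
proof -
  assume "x \<in> W k"
  then obtain v l where "v \<in> V" "l \<in> L" "x = v + 3 ^ k * l"
    unfolding W_def by blast
  moreover from this have "- x = (- v) + 3 ^ k * (- l)" by (simp add: algebra_simps)
  ultimately show ?thesis unfolding W_def using V_uminus L_uminus by blast
qed

lemma W_diff: "x \<in> W k \<Longrightarrow> y \<in> W k \<Longrightarrow> x - y \<in> W k"
  using W_add[of x k "- y"] W_uminus[of y k] by simp

lemma W_three: "x \<in> W k \<Longrightarrow> 3 * x \<in> W k"
  by (simp only: three_times W_add)

lemma W_of_nat: "x \<in> W k \<Longrightarrow> of_nat q * x \<in> W k"
  using V_sub_W[OF V_zero] by (induction q) (simp_all add: W_add algebra_simps)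

lemma W_three_Suc: "x \<in> W k \<Longrightarrow> 3 * x \<in> W (Suc k)"
proof -
  assume "x \<in> W k"
  then obtain v l where "v \<in> V" "l \<in> L" "x = v + 3 ^ k * l"
    unfolding W_def by blast
  moreover from this have "3 * x = 3 * v + 3 ^ Suc k * l" by (simp add: algebra_simps)
  ultimately show ?thesis unfolding W_def using V_three by blast
qed

lemma N_W:
  assumes "\<And>v. v \<in> V \<Longrightarrow> N v \<in> W k" and "x \<in> W k"
  shows "N x \<in> W k"
proof -
  from assms(2) obtain v l where vl: "v \<in> V" "l \<in> L" "x = v + 3 ^ k * l"
    unfolding W_def by blast
  then have "N x = N v + (0 + 3 ^ k * N l)"
    using V_sub by (simp add: N_add N_pow L_pow subsetD)
  moreover have "0 + 3 ^ k * N l \<in> W k"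
    unfolding W_def using V_zero N_closed[OF vl(2)] by blast
  ultimately show ?thesis using W_add[OF assms(1)[OF vl(1)]] by simp
qed

text \<open>\<open>W k\<close> consists of the elements that are congruent to elements of \<open>V\<close> modulo \<open>3\<^sup>k\<close>.  By closedness
  of \<open>V\<close> it is enough to improve an inclusion \<open>N V \<subseteq> W k\<close> by one power of \<open>3\<close>; under
  this hypothesis \<open>N\<close> also preserves \<open>W k\<close>, so that the higher powers of \<open>N\<close> are
  controlled too.\<close>

lemma M_V_if_N_W:
  assumes "\<And>k. (\<And>v. v \<in> V \<Longrightarrow> N v \<in> W k) \<Longrightarrow> (\<And>v. v \<in> V \<Longrightarrow> N v \<in> W (Suc k))"
    and "v \<in> V"
  shows "M v \<in> V"
proof -
  have "\<forall>v\<in>V. N v \<in> W k" for k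
    using assms(1) V_sub N_closed by (induction k) (auto simp: W_zero)
  then have "N v \<in> V"
    using V_sub assms(2) N_closed unfolding W_def by (intro V_closed) blast+
  then show ?thesis using assms(2) by (simp add: M_def V_add V_three)
qed

lemma M_three:
  assumes "x \<in> L"
  shows "M (M (M x)) = x + 3 * (3 * (N x + 3 * (N (N x) + N (N (N x)))))"
  using assms
  by (simp only: M_def N_add N_three N_closed L_add L_three) (simp add: algebra_simps)

text \<open>In \<open>M\<^sup>3 - 1 = 9 (N + 3 (N\<^sup>2 + N\<^sup>3))\<close> the linear term is less divisible by \<open>3\<close> than the others.
  Purity removes the factor \<open>9\<close>, and modulo \<open>V\<close> the remaining terms lie in \<open>3 W k\<close>.\<close>

lemma M_V_if_M_three_V:
  assumes "\<And>v. v \<in> V \<Longrightarrow> M (M (M v)) \<in> V" and "v \<in> V"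
  shows "M v \<in> V"
proof (rule M_V_if_N_W[OF _ assms(2)])
  fix k v
  assume NV: "\<And>v. v \<in> V \<Longrightarrow> N v \<in> W k" and v: "v \<in> V"
  let ?r = "N (N v) + N (N (N v))"
  have vL: "v \<in> L" using v V_sub by auto
  have r: "?r \<in> W k" by (intro W_add N_W[OF NV] V_sub_W v)
  have L: "N v + 3 * ?r \<in> L"
    using vL by (intro L_add L_three N_closed)
  have "3 * (3 * (N v + 3 * ?r)) \<in> V"
    using V_add[OF assms(1)[OF v] V_uminus[OF v]] by (simp add: M_three[OF vL])
  then have "N v + 3 * ?r \<in> V"
    by (rule V_pure[OF L V_pure[OF L_three[OF L]]])
  then have "(N v + 3 * ?r) - 3 * ?r \<in> W (Suc k)"
    using r by (intro W_diff[OF V_sub_W W_three_Suc])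
  then show "N v \<in> W (Suc k)" by simp
qed

lemma M_pow_expand:
  assumes NV: "\<And>v. v \<in> V \<Longrightarrow> N v \<in> W k" and v: "v \<in> V"
  shows "\<exists>x\<in>W k. (M ^^ q) v = v + 3 * (of_nat q * N v + 3 * x)"
proof (induction q)
  case 0
  then show ?case using V_sub_W[OF V_zero] by (intro bexI[of _ 0]) simp_all
next
  case (Suc q)
  then obtain x where x: "x \<in> W k" "(M ^^ q) v = v + 3 * (of_nat q * N v + 3 * x)" by blast
  have vL: "v \<in> L" and xL: "x \<in> L" using v V_sub x W_sub by auto
  let ?x = "x + of_nat q * N (N v) + 3 * N x"
  have "N (v + 3 * (of_nat q * N v + 3 * x)) = N v + 3 * (of_nat q * N (N v) + 3 * N x)"
    using vL xL by (simp only: N_add N_three N_closed L_add L_three L_of_nat N_of_nat)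
  moreover have "(M ^^ Suc q) v = (v + 3 * (of_nat q * N v + 3 * x))
      + 3 * N (v + 3 * (of_nat q * N v + 3 * x))"
    by (simp only: funpow.simps o_apply x(2) M_def)
  moreover have "(v + 3 * (of_nat q * N v + 3 * x)) + 3 * (N v + 3 * (of_nat q * N (N v) + 3 * N x))
      = v + 3 * (of_nat (Suc q) * N v + 3 * ?x)"
    by (simp add: algebra_simps)
  ultimately have "(M ^^ Suc q) v = v + 3 * (of_nat (Suc q) * N v + 3 * ?x)"
    by (simp only:)
  moreover have "?x \<in> W k"
    by (intro W_add W_of_nat W_three N_W[OF NV] V_sub_W v x(1))
  ultimately show ?case by blast
qed

text \<open>If \<open>q\<close> is prime to \<open>3\<close>, then \<open>M\<^sup>q - 1\<close> is \<open>3 q N\<close> up to a multiple of \<open>9\<close>, and \<open>q\<close> is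
  invertible modulo \<open>3\<close>.\<close>

lemma M_V_if_M_pow_V_coprime:
  assumes q: "\<not> 3 dvd q" and inv: "\<And>v. v \<in> V \<Longrightarrow> (M ^^ q) v \<in> V" and "v \<in> V"
  shows "M v \<in> V"
proof (rule M_V_if_N_W[OF _ assms(3)])
  fix k v
  assume NV: "\<And>v. v \<in> V \<Longrightarrow> N v \<in> W k" and v: "v \<in> V"
  have vL: "v \<in> L" using v V_sub by auto
  obtain x where x: "x \<in> W k" "(M ^^ q) v = v + 3 * (of_nat q * N v + 3 * x)"
    using M_pow_expand[OF NV v] by blast
  have xL: "x \<in> L" using x W_sub by auto
  have "3 * (of_nat q * N v + 3 * x) \<in> V"
    using V_add[OF inv[OF v] V_uminus[OF v]] by (simp add: x(2))
  moreover have "of_nat q * N v + 3 * x \<in> L"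
    using vL xL by (intro L_add L_of_nat N_closed L_three)
  ultimately have "of_nat q * N v + 3 * x \<in> V" by (rule V_pure[rotated])
  then have "(of_nat q * N v + 3 * x) - 3 * x \<in> W (Suc k)"
    using x(1) by (intro W_diff[OF V_sub_W W_three_Suc])
  then have qN: "of_nat q * N v \<in> W (Suc k)" by simp
  obtain r where r: "q = 3 * r + 1 \<or> q = 3 * r + 2"
    using q by (intro that[of "q div 3"]) presburger
  have rN: "3 * (of_nat i * N v) \<in> W (Suc k)" for i
    using NV[OF v] by (intro W_three_Suc W_of_nat)
  from r show "N v \<in> W (Suc k)"
  proof
    assume "q = 3 * r + 1"
    then have "N v = of_nat q * N v - 3 * (of_nat r * N v)" by (simp add: algebra_simps)
    then show ?thesis using W_diff[OF qN rN[of r]] by simp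
  next
    assume "q = 3 * r + 2"
    then have "N v = 3 * (of_nat (r + 1) * N v) - of_nat q * N v"
      by (simp add: algebra_simps)
    then show ?thesis using W_diff[OF rN[of "r + 1"] qN] by simp
  qed
qed

end

lemma (in minkowski) M_additive:
  "x \<in> L \<Longrightarrow> M x \<in> L" "x \<in> L \<Longrightarrow> y \<in> L \<Longrightarrow> M (x + y) = M x + M y"
  by (simp only: M_def L_add L_three N_closed)
     (simp add: M_def N_add algebra_simps)

lemma (in minkowski) M_pow_eq:
  "(M ^^ q) x = x + 3 * (\<Sum>i<q. N ((M ^^ i) x))"
  by (induction q) (simp_all add: M_def algebra_simps)

text \<open>Factors \<open>3\<close> of the exponent \<open>m\<close> are removed one at a time.  This is possible because
  \<open>M\<^sup>q\<close> is again of the form \<open>1 + 3 N'\<close>; what remains is an exponent prime to \<open>3\<close>.\<close>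

theorem (in minkowski) M_V_if_M_pow_V:
  assumes "m \<ge> 1" and "\<And>v. v \<in> V \<Longrightarrow> (M ^^ m) v \<in> V" and "v \<in> V"
  shows "M v \<in> V"
  using assms
proof (induction m arbitrary: v rule: less_induct)
  case (less m)
  show ?case
  proof (cases "3 dvd m")
    case False
    then show ?thesis using M_V_if_M_pow_V_coprime less.prems by blast
  next
    case True
    then obtain q where q: "m = 3 * q" by blast
    have pow: "(M ^^ i) x \<in> L \<and> (M ^^ i) (x + y) = (M ^^ i) x + (M ^^ i) y"
      if "x \<in> L" "y \<in> L" for i x y
      using that by (induction i arbitrary: x y) 
        (simp_all add: M_additive del: funpow.simps add: funpow_Suc_right)
    have sum: "(\<Sum>i<j. g i) \<in> L" if "\<And>i. g i \<in> L" for g and j :: nat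
      using that by (induction j) (simp_all add: L_zero L_add)
    \<comment> \<open>The operator for \<open>M\<^sup>q\<close>, which telescopes: \<open>M\<^sup>i\<^sup>+\<^sup>1 - M\<^sup>i = 3 N M\<^sup>i\<close>.\<close>
    interpret q: minkowski L V "\<lambda>x. \<Sum>i<q. N ((M ^^ i) x)"
    proof unfold_locales
      show "(\<Sum>i<q. N ((M ^^ i) x)) \<in> L" if "x \<in> L" for x
        using that pow by (intro sum N_closed) blast
      show "(\<Sum>i<q. N ((M ^^ i) (x + y))) = (\<Sum>i<q. N ((M ^^ i) x)) + (\<Sum>i<q. N ((M ^^ i) y))"
        if "x \<in> L" "y \<in> L" for x y
        using that by (simp add: pow N_add sum.distrib)
    qed
    have qM: "q.M = (M ^^ q)"
      by (rule ext) (simp only: q.M_def M_pow_eq[of q])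
    have "(M ^^ q) v \<in> V" if "v \<in> V" for v
    proof -
      have "q.M (q.M (q.M v)) \<in> V" if "v \<in> V" for v
      proof -
        have "m = q + (q + q)" using q by simp
        then show ?thesis
          using less.prems(2)[OF that] by (simp only: qM funpow_add o_apply)
      qed
      then have "q.M v \<in> V" using that by (rule q.M_V_if_M_three_V)
      then show ?thesis by (simp only: qM)
    qed
    then show ?thesis
      using less.IH[of q v] less.prems q by simp
  qed
qed

section \<open>Functions with highly divisible differences\<close>

lemma fun_three: "(3 :: 'a \<Rightarrow> 'b::comm_ring_1) x = 3"
proof -
  have "(3 :: 'a \<Rightarrow> 'b) x = (1 + 1 + 1 :: 'a \<Rightarrow> 'b) x" by simp
  also have "\<dots> = 1 + 1 + 1" by (simp only: plus_fun_def one_fun_def)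
  finally show ?thesis by simp
qed

lemma fun_power: "((f :: 'a \<Rightarrow> 'b::comm_ring_1) ^ k) x = f x ^ k"
  by (induction k) (simp_all add: one_fun_def times_fun_def)

fun differences_dvd :: "('a, 'b) monoid_scheme \<Rightarrow> nat \<Rightarrow> nat \<Rightarrow> ('a \<Rightarrow> 'r::comm_ring_1) \<Rightarrow> bool" where
  "differences_dvd G 0 k f \<longleftrightarrow> (\<forall>x\<in>carrier G. 3 ^ k dvd f x)"
| "differences_dvd G (Suc j) k f \<longleftrightarrow>
    (\<forall>g\<in>carrier G. differences_dvd G j k (\<lambda>x. f (g \<otimes>\<^bsub>G\<^esub> x) - f x))"

text \<open>Extended linearly to the group ring, the functions of level \<open>k\<close> are those that send the \<open>j\<close>-th power
  of the augmentation ideal into \<open>3\<^sup>j\<^sup>+\<^sup>k R\<close> for every \<open>j\<close>.  Iterated differences express this without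
  the group ring.\<close>

definition filtered :: "('a, 'b) monoid_scheme \<Rightarrow> nat \<Rightarrow> ('a \<Rightarrow> 'r::comm_ring_1) set" where
  "filtered G k = {f. \<forall>j. differences_dvd G j (j + k) f}"

definition class_function :: "('a, 'b) monoid_scheme \<Rightarrow> ('a \<Rightarrow> 'r) \<Rightarrow> bool" where
  "class_function G f \<longleftrightarrow>
    (\<forall>x\<in>carrier G. \<forall>g\<in>carrier G. f (g \<otimes>\<^bsub>G\<^esub> x \<otimes>\<^bsub>G\<^esub> inv\<^bsub>G\<^esub> g) = f x)"

context group
begin

lemma differences_dvd_cong:
  assumes "\<And>x. x \<in> carrier G \<Longrightarrow> f x = f' x"
  shows "differences_dvd G j k f = differences_dvd G j k f'"
  using assms
proof (induction j arbitrary: f f')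
  case (Suc j)
  have "differences_dvd G j k (\<lambda>x. f (g \<otimes> x) - f x) = differences_dvd G j k (\<lambda>x. f' (g \<otimes> x) - f' x)"
    if "g \<in> carrier G" for g
    using that Suc.prems by (intro Suc.IH) simp
  then show ?case by simp
qed simp

lemma differences_dvd_linear:
  assumes "differences_dvd G j k f" "differences_dvd G j k f'"
  shows "differences_dvd G j k (\<lambda>x. a * f x + b * f' x)"
  using assms
proof (induction j arbitrary: f f')
  case (Suc j)
  have "differences_dvd G j k (\<lambda>x. a * (f (g \<otimes> x) - f x) + b * (f' (g \<otimes> x) - f' x))"
    if "g \<in> carrier G" for g
    using that Suc.prems by (intro Suc.IH) simp_all
  then show ?case by (simp add: algebra_simps)
qed simp

lemma differences_dvd_mono: "differences_dvd G j (Suc k) f \<Longrightarrow> differences_dvd G j k f"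
proof (induction j arbitrary: f)
  case 0
  then show ?case by (auto elim!: dvd_trans[rotated] simp: power_Suc2 simp del: power_Suc)
qed simp

lemma differences_dvd_three:
  "differences_dvd G j k f \<Longrightarrow> differences_dvd G j (Suc k) (\<lambda>x. 3 * f x)"
proof (induction j arbitrary: f)
  case (Suc j)
  have "differences_dvd G j (Suc k) (\<lambda>x. 3 * (f (g \<otimes> x) - f x))" if "g \<in> carrier G" for g
    using that Suc.prems by (intro Suc.IH) simp
  then show ?case by (simp add: algebra_simps)
qed (simp add: mult_dvd_mono)

lemma differences_dvd_three_cancel:
  fixes f :: "'a \<Rightarrow> 'r::three_separated"
  shows "differences_dvd G j (Suc k) (\<lambda>x. 3 * f x) \<Longrightarrow> differences_dvd G j k f"
proof (induction j arbitrary: f)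
  case (Suc j)
  have "differences_dvd G j (Suc k) (\<lambda>x. 3 * (f (g \<otimes> x) - f x))" if "g \<in> carrier G" for g
    using that Suc.prems by (simp add: algebra_simps)
  then show ?case using Suc.IH by simp
qed (simp add: three_nonzero)

lemma differences_dvd_translate:
  assumes "h \<in> carrier G" "differences_dvd G j k f"
  shows "differences_dvd G j k (\<lambda>x. f (h \<otimes> x))"
  using assms(2)
proof (induction j arbitrary: f)
  case 0
  then show ?case using assms(1) by simp
next
  case (Suc j)
  have "differences_dvd G j k (\<lambda>x. f (h \<otimes> (g \<otimes> x)) - f (h \<otimes> x))" if g: "g \<in> carrier G" for g
  proof -
    let ?g = "h \<otimes> g \<otimes> inv h"
    have "differences_dvd G j k (\<lambda>x. f (?g \<otimes> x) - f x)"
      using Suc.prems g assms(1) by simp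
    then have "differences_dvd G j k (\<lambda>x. f (?g \<otimes> (h \<otimes> x)) - f (h \<otimes> x))"
      by (rule Suc.IH)
    moreover have "?g \<otimes> (h \<otimes> x) = h \<otimes> (g \<otimes> x)" if "x \<in> carrier G" for x
      using that g assms(1) by (simp add: m_assoc inv_solve_left)
         (metis inv_closed l_inv l_one m_assoc m_closed)
    ultimately show ?thesis
      by (subst (asm) differences_dvd_cong) simp_all
  qed
  then show ?case by simp
qed

lemma filtered_linear:
  "f \<in> filtered G k \<Longrightarrow> f' \<in> filtered G k \<Longrightarrow> (\<lambda>x. a * f x + b * f' x) \<in> filtered G k"
  by (simp add: filtered_def differences_dvd_linear)

lemma filtered_add: "f \<in> filtered G k \<Longrightarrow> f' \<in> filtered G k \<Longrightarrow> (\<lambda>x. f x + f' x) \<in> filtered G k"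
  using filtered_linear[of f k f' 1 1] by simp

lemma filtered_diff: "f \<in> filtered G k \<Longrightarrow> f' \<in> filtered G k \<Longrightarrow> (\<lambda>x. f x - f' x) \<in> filtered G k"
  using filtered_linear[of f k f' 1 "-1"] by simp

lemma filtered_uminus: "f \<in> filtered G k \<Longrightarrow> (\<lambda>x. - f x) \<in> filtered G k"
  using filtered_linear[of f k f "-1" 0] by simp

lemma filtered_three: "f \<in> filtered G k \<Longrightarrow> (\<lambda>x. 3 * f x) \<in> filtered G (Suc k)"
  by (simp add: filtered_def differences_dvd_three)

lemma filtered_mono: "f \<in> filtered G (Suc k) \<Longrightarrow> f \<in> filtered G k"
  by (simp add: filtered_def differences_dvd_mono)

lemma filtered_translate: "h \<in> carrier G \<Longrightarrow> f \<in> filtered G k \<Longrightarrow> (\<lambda>x. f (h \<otimes> x)) \<in> filtered G k"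
  by (simp add: filtered_def differences_dvd_translate)

text \<open>Taking a difference uses up one of the factors of the augmentation ideal, which raises the level.\<close>

lemma filtered_difference:
  assumes "g \<in> carrier G" "f \<in> filtered G k"
  shows "(\<lambda>x. f (g \<otimes> x) - f x) \<in> filtered G (Suc k)"
proof -
  have "differences_dvd G (Suc j) (Suc j + k) f" for j
    using assms(2) by (simp only: filtered_def) blast
  then show ?thesis using assms(1) by (simp add: filtered_def)
qed

lemma filtered_const: "(\<lambda>_. c :: 'r::comm_ring_1) \<in> filtered G 0"
proof -
  have "differences_dvd G j k (\<lambda>_. 0 :: 'r::comm_ring_1)" for j k
    by (induction j) simp_all
  then have "differences_dvd G j j (\<lambda>_. c)" for j
    by (cases j) simp_all
  then show ?thesis by (simp add: filtered_def)
qed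

lemma filtered_cong:
  assumes "f \<in> filtered G k" "\<And>x. x \<in> carrier G \<Longrightarrow> f x = f' x"
  shows "f' \<in> filtered G k"
  using assms differences_dvd_cong[of f f'] by (simp add: filtered_def)

lemma filtered_difference_mult:
  assumes "(\<lambda>x. f (g \<otimes> x) - f x) \<in> filtered G k" "(\<lambda>x. f (h \<otimes> x) - f x) \<in> filtered G k"
    and gh: "g \<in> carrier G" "h \<in> carrier G"
  shows "(\<lambda>x. f (g \<otimes> h \<otimes> x) - f x) \<in> filtered G k"
proof -
  have "(\<lambda>x. (f (g \<otimes> (h \<otimes> x)) - f (h \<otimes> x)) + (f (h \<otimes> x) - f x)) \<in> filtered G k"
    using filtered_translate[OF gh(2) assms(1)] assms(2) by (rule filtered_add)
  then show ?thesis by (rule filtered_cong) (simp add: gh m_assoc)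
qed

lemma filtered_difference_inv:
  assumes "(\<lambda>x. f (g \<otimes> x) - f x) \<in> filtered G k" and g: "g \<in> carrier G"
  shows "(\<lambda>x. f (inv g \<otimes> x) - f x) \<in> filtered G k"
proof -
  have "(\<lambda>x. - (f (g \<otimes> (inv g \<otimes> x)) - f (inv g \<otimes> x))) \<in> filtered G k"
    using filtered_uminus[OF filtered_translate[OF inv_closed[OF g] assms(1)]] .
  then show ?thesis by (rule filtered_cong) (simp add: g flip: m_assoc)
qed

text \<open>In the group ring \<open>g h - h g = (g - 1) (h - 1) - (h - 1) (g - 1)\<close>, so that a commutator acts through
  second differences.\<close>

lemma filtered_difference_commutator:
  assumes f: "f \<in> filtered G k" and g: "g \<in> carrier G" and h: "h \<in> carrier G"
  shows "(\<lambda>x. f (g \<otimes> h \<otimes> inv g \<otimes> inv h \<otimes> x) - f x) \<in> filtered G (k + 2)"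
proof -
  let ?d = "\<lambda>x. (f (g \<otimes> (h \<otimes> x)) - f (h \<otimes> x)) - (f (g \<otimes> x) - f x)"
  let ?e = "\<lambda>x. (f (h \<otimes> (g \<otimes> x)) - f (g \<otimes> x)) - (f (h \<otimes> x) - f x)"
  have "(\<lambda>x. ?d x - ?e x) \<in> filtered G (k + 2)"
    using filtered_difference[OF h filtered_difference[OF g f]]
      filtered_difference[OF g filtered_difference[OF h f]]
    unfolding add_2_eq_Suc' by (rule filtered_diff)
  then have "(\<lambda>x. ?d (inv g \<otimes> inv h \<otimes> x) - ?e (inv g \<otimes> inv h \<otimes> x)) \<in> filtered G (k + 2)"
    using g h by (intro filtered_translate) simp_all
  then show ?thesis
  proof (rule filtered_cong)
    fix x assume x: "x \<in> carrier G"
    have "h \<otimes> (g \<otimes> (inv g \<otimes> inv h \<otimes> x)) = x"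
      using g h x by (metis inv_closed m_assoc m_closed r_inv l_one)
    moreover have "g \<otimes> (h \<otimes> (inv g \<otimes> inv h \<otimes> x)) = g \<otimes> h \<otimes> inv g \<otimes> inv h \<otimes> x"
      using g h x by (simp add: m_assoc)
    ultimately show "?d (inv g \<otimes> inv h \<otimes> x) - ?e (inv g \<otimes> inv h \<otimes> x)
        = f (g \<otimes> h \<otimes> inv g \<otimes> inv h \<otimes> x) - f x"
      by simp
  qed
qed

lemma filtered_difference_derived:
  fixes f :: "'a \<Rightarrow> 'r::comm_ring_1"
  assumes f: "f \<in> filtered G k" and d: "d \<in> derived G (carrier G)"
  shows "(\<lambda>x. f (d \<otimes> x) - f x) \<in> filtered G (k + 2)"
proof -
  have inG: "d \<in> carrier G" if "d \<in> derived G (carrier G)" for d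
    using derived_in_carrier[OF subset_refl] that by blast
  from d show ?thesis
    unfolding derived_def
  proof (induction rule: generate.induct)
    case one
    have "(\<lambda>_. 0 :: 'r) \<in> filtered G (k + 2)"
      using filtered_linear[OF filtered_three[OF filtered_three[OF f]]
          filtered_three[OF filtered_three[OF f]], of 0 0] by simp
    then show ?case by (rule filtered_cong) simp
  next
    case (incl c)
    then show ?case using filtered_difference_commutator[OF f] by blast
  next
    case (inv c)
    then obtain g h where "g \<in> carrier G" "h \<in> carrier G" "c = g \<otimes> h \<otimes> inv g \<otimes> inv h" by blast
    then show ?case
      using filtered_difference_commutator[OF f, of g h] filtered_difference_inv[of f c "k + 2"] by simp
  next
    case (eng c d)
    then show ?case
      using inG unfolding derived_def by (intro filtered_difference_mult) blast+
  qed
qed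

text \<open>In the group ring \<open>y\<^sup>3 - 1 = 3 (y - 1) + 3 (y - 1)\<^sup>2 + (y - 1)\<^sup>3\<close>, and every summand raises the level
  by at least \<open>2\<close>.\<close>

lemma filtered_difference_cube:
  fixes f :: "'a \<Rightarrow> 'r::comm_ring_1"
  assumes f: "f \<in> filtered G k" and y: "y \<in> carrier G"
  shows "(\<lambda>x. f (y [^] (3::nat) \<otimes> x) - f x) \<in> filtered G (k + 2)"
proof -
  let ?D = "\<lambda>f x. f (y \<otimes> x) - f x"
  have D: "?D f \<in> filtered G (Suc k)" if "f \<in> filtered G k" for f :: "'a \<Rightarrow> 'r" and k
    using filtered_difference[OF y that] .
  have "(\<lambda>x. (3 * ?D f x + 3 * ?D (?D f) x) + ?D (?D (?D f)) x) \<in> filtered G (k + 2)"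
  proof (intro filtered_add)
    show "(\<lambda>x. 3 * ?D f x) \<in> filtered G (k + 2)"
      using filtered_three[OF D[OF f]] by simp
    show "(\<lambda>x. 3 * ?D (?D f) x) \<in> filtered G (k + 2)"
      using filtered_mono[OF filtered_three[OF D[OF D[OF f]]]] by simp
    show "?D (?D (?D f)) \<in> filtered G (k + 2)"
      using filtered_mono[OF D[OF D[OF D[OF f]]]] by simp
  qed
  then show ?thesis
  proof (rule filtered_cong)
    fix x assume "x \<in> carrier G"
    then have "y [^] (3::nat) \<otimes> x = y \<otimes> (y \<otimes> (y \<otimes> x))"
      using y by (simp add: numeral_3_eq_3 m_assoc)
    then show "(3 * ?D f x + 3 * ?D (?D f) x) + ?D (?D (?D f)) x = f (y [^] (3::nat) \<otimes> x) - f x"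
      by (simp add: algebra_simps)
  qed
qed

end

text \<open>The assumption \<open>congruent\<close> says that \<open>\<Phi>\<close> induces the identity on \<open>H\<^sub>1(G; \<int>/3)\<close>.\<close>

locale congruence_endomorphism = group +
  fixes \<Phi>
  assumes hom: "\<Phi> \<in> hom G G"
    and congruent: "x \<in> carrier G \<Longrightarrow>
      \<exists>d\<in>derived G (carrier G). \<exists>y\<in>carrier G. \<Phi> x = d \<otimes> y [^] (3::nat) \<otimes> x"
begin

lemma closed: "x \<in> carrier G \<Longrightarrow> \<Phi> x \<in> carrier G"
  using hom by (auto simp: hom_def)

lemma filtered_displacement:
  assumes f: "f \<in> filtered G k" and x: "x \<in> carrier G"
  shows "(\<lambda>z. f (\<Phi> x \<otimes> z) - f (x \<otimes> z)) \<in> filtered G (k + 2)"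
proof -
  obtain d y where dy: "d \<in> derived G (carrier G)" "y \<in> carrier G" "\<Phi> x = d \<otimes> y [^] (3::nat) \<otimes> x"
    using congruent[OF x] by blast
  have d: "d \<in> carrier G"
    using derived_in_carrier[OF subset_refl] dy(1) by blast
  have "(\<lambda>z. f (d \<otimes> y [^] (3::nat) \<otimes> z) - f z) \<in> filtered G (k + 2)"
    using dy d f
    by (intro filtered_difference_mult filtered_difference_derived filtered_difference_cube) auto
  then have "(\<lambda>z. f (d \<otimes> y [^] (3::nat) \<otimes> (x \<otimes> z)) - f (x \<otimes> z)) \<in> filtered G (k + 2)"
    by (rule filtered_translate[OF x])
  then show ?thesis
    by (rule filtered_cong) (simp add: dy d x m_assoc)
qed

text \<open>The induction on the number \<open>j\<close> of differences rests on the identity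
  \<open>D\<^sub>g (f \<circ> \<Phi> - f) = (f' \<circ> \<Phi> - f') + (f' - D\<^sub>g f)\<close>, where \<open>D\<^sub>g f\<close> is the function
  \<open>x \<mapsto> f (g x) - f x\<close> and \<open>f' = D\<^sub>\<Phi>\<^sub>g f\<close>.  The function \<open>f'\<close> has a higher level than
  \<open>f\<close>, which makes up for the difference taken, and the second summand involves the
  displacement of the single element \<open>g\<close>.\<close>

lemma filtered_pullback:
  assumes "f \<in> filtered G k"
  shows "(\<lambda>x. f (\<Phi> x) - f x) \<in> filtered G (Suc k)"
proof -
  have "differences_dvd G j (j + Suc k) (\<lambda>x. f (\<Phi> x) - f x)" for j
    using assms
  proof (induction j arbitrary: f k)
    case 0
    have "3 ^ Suc k dvd f (\<Phi> x) - f x" if x: "x \<in> carrier G" for x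
    proof -
      have "differences_dvd G 0 (0 + Suc k) (\<lambda>z. f (\<Phi> x \<otimes> z) - f (x \<otimes> z))"
        using filtered_mono[of _ "Suc k", OF filtered_displacement[OF 0 x, simplified]]
        unfolding filtered_def by blast
      then have "3 ^ Suc k dvd f (\<Phi> x \<otimes> \<one>) - f (x \<otimes> \<one>)"
        unfolding differences_dvd.simps(1) by (simp del: power_Suc)
      then show ?thesis using x closed by simp
    qed
    then show ?case by simp
  next
    case (Suc j)
    have "differences_dvd G j (Suc j + Suc k)
        (\<lambda>x. (f (\<Phi> (g \<otimes> x)) - f (g \<otimes> x)) - (f (\<Phi> x) - f x))" if g: "g \<in> carrier G" for g
    proof -
      let ?f = "\<lambda>x. f (\<Phi> g \<otimes> x) - f x"
      have "differences_dvd G j (j + Suc (Suc k)) (\<lambda>x. ?f (\<Phi> x) - ?f x)"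
        by (intro Suc.IH filtered_difference closed g Suc.prems)
      moreover have "differences_dvd G j (j + Suc (Suc k)) (\<lambda>x. f (\<Phi> g \<otimes> x) - f (g \<otimes> x))"
        using filtered_displacement[OF Suc.prems g] by (simp add: filtered_def)
      ultimately have "differences_dvd G j (j + Suc (Suc k))
          (\<lambda>x. 1 * (?f (\<Phi> x) - ?f x) + 1 * (f (\<Phi> g \<otimes> x) - f (g \<otimes> x)))"
        by (rule differences_dvd_linear)
      then have "differences_dvd G j (j + Suc (Suc k))
        (\<lambda>x. (f (\<Phi> (g \<otimes> x)) - f (g \<otimes> x)) - (f (\<Phi> x) - f x))"
        using g hom by (subst (asm) differences_dvd_cong) (auto simp: hom_def)
      then show ?thesis by simp
    qed
    then show ?case by simp
  qed
  then show ?thesis by (simp add: filtered_def)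
qed

text \<open>This is the argument of Minkowski applied to \<open>f \<mapsto> f \<circ> \<Phi>\<close>, with \<open>L\<close> the class functions of level
  \<open>0\<close> and \<open>V\<close> those that vanish on \<open>A\<close>.\<close>

theorem class_function_vanishes_on_image:
  fixes f :: "'a \<Rightarrow> 'r::three_separated"
  assumes A: "A \<subseteq> carrier G" and "m \<ge> 1"
    and period: "\<And>a. a \<in> A \<Longrightarrow> \<exists>g\<in>carrier G. \<exists>b\<in>A. (\<Phi> ^^ m) a = g \<otimes> b \<otimes> inv g"
    and f: "f \<in> filtered G 0" "class_function G f" "\<And>a. a \<in> A \<Longrightarrow> f a = 0"
    and a: "a \<in> A"
  shows "f (\<Phi> a) = 0"
proof -
  interpret \<Phi>: group_hom G G \<Phi>
    by unfold_locales (rule hom)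
  define L where "L = {f \<in> filtered G 0. class_function G (f :: 'a \<Rightarrow> 'r)}"
  define V where "V = {f \<in> L. \<forall>a\<in>A. f a = 0}"
  \<comment> \<open>The value \<open>0\<close> off the carrier makes \<open>N\<close> additive as an operator on total functions.\<close>
  define N where "N = (\<lambda>f x. if x \<in> carrier G then (f (\<Phi> x) - f x :: 'r) div 3 else 0)"
  have N: "f (\<Phi> x) = f x + 3 * N f x" if "f \<in> L" "x \<in> carrier G" for f x
  proof -
    have "differences_dvd G 0 (0 + Suc 0) (\<lambda>x. f (\<Phi> x) - f x)"
      using filtered_pullback[of f 0] that(1) unfolding filtered_def L_def by blast
    then have "3 dvd f (\<Phi> x) - f x" using that(2) by simp
    then obtain c where c: "f (\<Phi> x) - f x = 3 * c" by (rule dvdE)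
    then have "N f x = c"
      using that(2) three_nonzero[where ?'a = 'r] 
      by (simp only: N_def if_True nonzero_mult_div_cancel_left not_False_eq_True)
    with c show ?thesis by (metis add.commute diff_add_cancel)
  qed
  have three_cancel: "y = z" if "3 * y = 3 * z" for y z :: 'r
    using that three_nonzero[where ?'a = 'r] by simp
  interpret minkowski L V N
  proof
    show "0 \<in> L"
      using filtered_const[of "0::'r"] by (simp add: L_def class_function_def zero_fun_def)
    then show "0 \<in> V" by (simp add: V_def)
    show L_add: "f + g \<in> L" if "f \<in> L" "g \<in> L" for f g
      using that filtered_add[of f 0 g] by (auto simp: L_def class_function_def plus_fun_def)
    then show "f + g \<in> V" if "f \<in> V" "g \<in> V" for f g
      using that by (auto simp: V_def)
    show L_uminus: "- f \<in> L" if "f \<in> L" for f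
      using that filtered_uminus[of f 0] by (auto simp: L_def class_function_def fun_Compl_def)
    then show "- f \<in> V" if "f \<in> V" for f
      using that by (auto simp: V_def)
    show "V \<subseteq> L" by (auto simp: V_def)
    show "f \<in> V" if "f \<in> L" "3 * f \<in> V" for f
    proof -
      have "f a = 0" if "a \<in> A" for a
      proof (rule three_cancel)
        show "3 * f a = 3 * 0"
          using \<open>3 * f \<in> V\<close> that by (auto simp: V_def times_fun_def fun_three)
      qed
      with that show ?thesis by (simp add: V_def)
    qed
    show "f \<in> V" if "f \<in> L" "\<And>k. \<exists>v\<in>V. \<exists>l\<in>L. f = v + 3 ^ k * l" for f
    proof -
      have "f a = 0" if "a \<in> A" for a
      proof (rule three_separated)
        fix k :: nat
        obtain v l where "v \<in> V" "f = v + 3 ^ k * l"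
          using \<open>\<And>k. \<exists>v\<in>V. \<exists>l\<in>L. f = v + 3 ^ k * l\<close> by blast
        then show "3 ^ k dvd f a"
          using that by (simp add: V_def plus_fun_def times_fun_def fun_power fun_three)
      qed
      with that show ?thesis by (simp add: V_def)
    qed
    show "N f \<in> L" if "f \<in> L" for f
    proof -
      have "(\<lambda>x. 3 * N f x) \<in> filtered G (Suc 0)"
        using that filtered_pullback[of f 0] N[OF that]
        by (intro filtered_cong[OF filtered_pullback[of f 0]]) (auto simp: L_def)
      then have "N f \<in> filtered G 0"
        by (auto simp: filtered_def intro: differences_dvd_three_cancel)
      moreover have "N f (g \<otimes> x \<otimes> inv g) = N f x" if "x \<in> carrier G" "g \<in> carrier G" for g x
        using \<open>f \<in> L\<close> that closed by (simp add: L_def class_function_def N_def)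
      ultimately show ?thesis by (simp add: L_def class_function_def)
    qed
    show "N (f + g) = N f + N g" if "f \<in> L" "g \<in> L" for f g
    proof
      fix x
      show "N (f + g) x = (N f + N g) x"
      proof (cases "x \<in> carrier G")
        case True
        have "3 * N (f + g) x = 3 * (N f x + N g x)"
          using N[OF L_add[OF that] True] N[OF that(1) True] N[OF that(2) True]
          by (simp add: plus_fun_def algebra_simps)
        then have "N (f + g) x = N f x + N g x" by (rule three_cancel)
        then show ?thesis by (simp add: plus_fun_def)
      qed (simp add: N_def plus_fun_def)
    qed
  qed
  have M: "M f x = f (\<Phi> x)" if "f \<in> L" "x \<in> carrier G" for f x
    using N[OF that] by (simp add: M_def plus_fun_def times_fun_def fun_three)
  have M_pow: "(M ^^ i) f \<in> L \<and> (\<forall>x\<in>carrier G. (M ^^ i) f x = f ((\<Phi> ^^ i) x))"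
    if "f \<in> L" for i f
  proof (induction i)
    case (Suc i)
    have "(M ^^ Suc i) f x = f ((\<Phi> ^^ Suc i) x)" if "x \<in> carrier G" for x
    proof -
      have "(M ^^ Suc i) f x = (M ^^ i) f (\<Phi> x)"
        using Suc M[of "(M ^^ i) f" x] that by simp
      also have "\<dots> = f ((\<Phi> ^^ i) (\<Phi> x))" using Suc that closed by simp
      finally show ?thesis by (simp add: funpow_swap1)
    qed
    then show ?case using Suc by (simp add: M_additive)
  qed (use that in simp)
  have "(M ^^ m) v \<in> V" if "v \<in> V" for v
  proof -
    have vL: "v \<in> L" using that by (simp add: V_def)
    have "(M ^^ m) v a = 0" if a: "a \<in> A" for a
    proof -
      obtain g b where "g \<in> carrier G" "b \<in> A" "(\<Phi> ^^ m) a = g \<otimes> b \<otimes> inv g"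
        using period[OF a] by blast
      then show ?thesis
        using M_pow[OF vL, of m] \<open>v \<in> V\<close> A a
        by (auto simp: V_def L_def class_function_def subset_iff)
    qed
    then show ?thesis using M_pow[OF vL, of m] by (simp add: V_def)
  qed
  moreover have "f \<in> V" using f by (simp add: V_def L_def)
  ultimately have "M f \<in> V" by (rule M_V_if_M_pow_V[OF \<open>m \<ge> 1\<close>])
  then show ?thesis
    using a A f M[of f a] by (auto simp: V_def L_def)
qed

end

section \<open>Matrices and their traces\<close>

datatype 'a mat2 = Mat2 (m11: 'a) (m12: 'a) (m21: 'a) (m22: 'a)

instantiation mat2 :: (comm_ring_1) ring_1
begin

definition "0 = Mat2 0 0 0 0"
definition "1 = Mat2 1 0 0 1"
definition "X + Y = Mat2 (m11 X + m11 Y) (m12 X + m12 Y) (m21 X + m21 Y) (m22 X + m22 Y)"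
definition "X - Y = Mat2 (m11 X - m11 Y) (m12 X - m12 Y) (m21 X - m21 Y) (m22 X - m22 Y)"
definition "- X = Mat2 (- m11 X) (- m12 X) (- m21 X) (- m22 X)"
definition "X * Y = Mat2
  (m11 X * m11 Y + m12 X * m21 Y) (m11 X * m12 Y + m12 X * m22 Y)
  (m21 X * m11 Y + m22 X * m21 Y) (m21 X * m12 Y + m22 X * m22 Y)"

instance
  by standard
    (simp_all add: zero_mat2_def one_mat2_def plus_mat2_def minus_mat2_def uminus_mat2_def
      times_mat2_def mat2.expand algebra_simps)

end

lemmas mat2_defs =
  zero_mat2_def one_mat2_def plus_mat2_def minus_mat2_def uminus_mat2_def times_mat2_def

definition trace :: "'a::comm_ring_1 mat2 \<Rightarrow> 'a" where
  "trace X = m11 X + m22 X"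

lemma trace_commute: "trace (X * Y) = trace (Y * X)"
  by (simp add: trace_def mat2_defs algebra_simps)

definition entries_dvd :: "'a::comm_ring_1 \<Rightarrow> 'a mat2 \<Rightarrow> bool" where
  "entries_dvd r X \<longleftrightarrow> r dvd m11 X \<and> r dvd m12 X \<and> r dvd m21 X \<and> r dvd m22 X"

lemma entries_dvd_mult: "entries_dvd r X \<Longrightarrow> entries_dvd s Y \<Longrightarrow> entries_dvd (r * s) (X * Y)"
  by (simp add: entries_dvd_def times_mat2_def mult_dvd_mono)

lemma entries_dvd_add: "entries_dvd r X \<Longrightarrow> entries_dvd r Y \<Longrightarrow> entries_dvd r (X + Y)"
  by (simp add: entries_dvd_def plus_mat2_def)

lemma entries_dvd_one: "entries_dvd 1 X"
  by (simp add: entries_dvd_def)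

lemma entries_dvd_zero: "entries_dvd r 0"
  by (simp add: entries_dvd_def zero_mat2_def)

lemma entries_dvd_conj: "entries_dvd r X \<Longrightarrow> entries_dvd r (Y * X * Z)"
  using entries_dvd_mult[OF entries_dvd_mult[OF entries_dvd_one[of Y], of r X] entries_dvd_one[of Z]]
  by simp

lemma entries_dvd_mult_one:
  assumes "entries_dvd r (X - 1)" "entries_dvd r (Y - 1)"
  shows "entries_dvd r (X * Y - 1)"
proof -
  have "X * Y - 1 = 1 * (X - 1) * Y + (Y - 1)" by (simp add: algebra_simps)
  then show ?thesis
    using assms by (simp only: entries_dvd_add entries_dvd_conj)
qed

definition mult_hom :: "('a, 'b) monoid_scheme \<Rightarrow> ('a \<Rightarrow> 'k::monoid_mult) \<Rightarrow> bool" where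
  "mult_hom G \<rho> \<longleftrightarrow> \<rho> \<one>\<^bsub>G\<^esub> = 1 \<and>
    (\<forall>x\<in>carrier G. \<forall>y\<in>carrier G. \<rho> (x \<otimes>\<^bsub>G\<^esub> y) = \<rho> x * \<rho> y)"

context group
begin

text \<open>For a matrix \<open>X\<close> divisible by \<open>3\<^sup>k\<close>, the difference by \<open>g\<close> of \<open>x \<mapsto> tr (X \<rho>(x))\<close> is the function
  of the same kind for \<open>X (\<rho>(g) - 1)\<close>, which is divisible by \<open>3\<^sup>k\<^sup>+\<^sup>1\<close>.\<close>

lemma trace_filtered:
  fixes \<rho> :: "'a \<Rightarrow> 'r::comm_ring_1 mat2"
  assumes "mult_hom G \<rho>" and three: "\<And>g. g \<in> carrier G \<Longrightarrow> entries_dvd 3 (\<rho> g - 1)"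
  shows "(\<lambda>x. trace (\<rho> x)) \<in> filtered G 0"
proof -
  have "differences_dvd G j (j + k) (\<lambda>x. trace (X * \<rho> x))" if "entries_dvd (3 ^ k) X" for X j k
    using that
  proof (induction j arbitrary: X k)
    case 0
    then show ?case
      by (simp add: trace_def times_mat2_def entries_dvd_def)
  next
    case (Suc j)
    have "differences_dvd G j (Suc j + k) (\<lambda>x. trace (X * \<rho> (g \<otimes> x)) - trace (X * \<rho> x))"
      if g: "g \<in> carrier G" for g
    proof -
      have "entries_dvd (3 ^ Suc k) (X * (\<rho> g - 1))"
        using entries_dvd_mult[OF Suc.prems three[OF g]] by (simp add: mult.commute)
      from Suc.IH[OF this]
      have "differences_dvd G j (j + Suc k) (\<lambda>x. trace (X * (\<rho> g - 1) * \<rho> x))" .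
      moreover have "trace (X * (\<rho> g - 1) * \<rho> x) = trace (X * \<rho> (g \<otimes> x)) - trace (X * \<rho> x)"
        if "x \<in> carrier G" for x
        using assms(1) g that
        by (simp add: mult_hom_def algebra_simps) (simp add: trace_def minus_mat2_def)
      ultimately show ?thesis
        by (subst (asm) differences_dvd_cong) simp_all
    qed
    then show ?case by simp
  qed
  from this[of 0 1] have "differences_dvd G j j (\<lambda>x. trace (\<rho> x))" for j
    by (simp add: entries_dvd_one)
  then show ?thesis by (simp add: filtered_def)
qed

lemma trace_class_function:
  assumes "mult_hom G \<rho>"
  shows "class_function G (\<lambda>x. trace (\<rho> x))"
proof -
  have "trace (\<rho> (g \<otimes> x \<otimes> inv g)) = trace (\<rho> x)" if "x \<in> carrier G" "g \<in> carrier G" for x g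
  proof -
    have "trace (\<rho> (g \<otimes> x \<otimes> inv g)) = trace (\<rho> (inv g) * (\<rho> g * \<rho> x))"
      using assms that by (simp add: mult_hom_def trace_commute)
    also have "\<rho> (inv g) * (\<rho> g * \<rho> x) = \<rho> (inv g \<otimes> (g \<otimes> x))"
      using assms that by (simp add: mult_hom_def)
    also have "inv g \<otimes> (g \<otimes> x) = x" using that by (simp flip: m_assoc)
    finally show ?thesis .
  qed
  then show ?thesis by (simp add: class_function_def)
qed

end

text \<open>Coefficients in a formal degree \<open>d\<close>, which may exceed the true degree, are multiplicative and
  additive without any hypothesis of nonvanishing.  This makes them usable entry by entry.\<close>

definition leading :: "nat \<Rightarrow> 'a::comm_ring_1 poly \<Rightarrow> 'a \<Rightarrow> bool" where
  "leading d p c \<longleftrightarrow> degree p \<le> d \<and> coeff p d = c"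

lemma leading_mult:
  assumes "leading d p a" "leading e q b"
  shows "leading (d + e) (p * q) (a * b)"
proof -
  have "coeff (p * q) (d + e) = (\<Sum>i\<le>d + e. coeff p i * coeff q (d + e - i))"
    by (simp add: coeff_mult)
  also have "\<dots> = (\<Sum>i\<le>d + e. if i = d then coeff p d * coeff q e else 0)"
  proof (rule sum.cong[OF refl])
    fix i assume "i \<in> {..d + e}"
    show "coeff p i * coeff q (d + e - i) = (if i = d then coeff p d * coeff q e else 0)"
    proof (cases i d rule: linorder_cases)
      case less
      then have "degree q < d + e - i" using assms(2) unfolding leading_def by linarith
      then show ?thesis using less by (simp add: coeff_eq_0)
    next
      case greater
      then have "degree p < i" using assms(1) by (simp add: leading_def)
      then show ?thesis using greater by (simp add: coeff_eq_0)
    qed simp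
  qed
  also have "\<dots> = a * b" using assms by (simp add: leading_def)
  finally show ?thesis
    using assms degree_mult_le[of p q] by (simp add: leading_def)
qed

lemma leading_add: "leading d p a \<Longrightarrow> leading d q b \<Longrightarrow> leading d (p + q) (a + b)"
  by (simp add: leading_def degree_add_le)

definition mat_leading :: "nat \<Rightarrow> 'a::comm_ring_1 poly mat2 \<Rightarrow> 'a mat2 \<Rightarrow> bool" where
  "mat_leading d X N \<longleftrightarrow> leading d (m11 X) (m11 N) \<and> leading d (m12 X) (m12 N) \<and>
    leading d (m21 X) (m21 N) \<and> leading d (m22 X) (m22 N)"

lemma mat_leading_mult:
  "mat_leading d X M \<Longrightarrow> mat_leading e Y N \<Longrightarrow> mat_leading (d + e) (X * Y) (M * N)"
  by (simp add: mat_leading_def times_mat2_def leading_mult leading_add)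

lemma mat_leading_trace: "mat_leading d X N \<Longrightarrow> leading d (trace X) (trace N)"
  by (simp add: mat_leading_def trace_def leading_add)

section \<open>A representation of the free group congruent to the identity modulo three\<close>

text \<open>The slopes of letters are distinct, which keeps products of the nilpotent matrices below from
  vanishing, and positive, which keeps lower left entries from vanishing.\<close>

definition slope :: "nat \<times> bool \<Rightarrow> int" where
  "slope l = 2 * int (fst l) + (if snd l then 1 else 2)"

lemma slope_eq_iff: "slope l = slope l' \<longleftrightarrow> l = l'"
  by (auto simp: slope_def prod_eq_iff split: if_splits) presburger+

lemma slope_pos: "slope l > 0"
  by (simp add: slope_def)

text \<open>With \<open>v = (1, m)\<close> and \<open>w = (- m, 1)\<close>, this is \<open>1 + 3 e t N\<close> for the nilpotent matrix \<open>N\<close> of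
  rank one with entries \<open>v\<^sub>i w\<^sub>j\<close>: a transvection that fixes the line of slope \<open>m\<close>.  The products of
  such matrices \<open>N\<close> for different slopes do not vanish.\<close>

definition shear :: "int \<Rightarrow> int \<Rightarrow> int poly mat2" where
  "shear e m = (let c = [:0, 3 * e:] in
    Mat2 (1 - c * [:m:]) c (- c * [:m\<^sup>2:]) (1 + c * [:m:]))"

lemma shear_inverse: "shear e m * shear (- e) m = 1"
  by (simp add: shear_def Let_def mat2_defs one_pCons power2_eq_square algebra_simps)

lemma mat_leading_shear:
  "mat_leading 1 (shear e m) (Mat2 (- 3 * e * m) (3 * e) (- 3 * e * m\<^sup>2) (3 * e * m))"
  by (simp add: mat_leading_def leading_def shear_def Let_def one_pCons)

lemma entries_dvd_shear: "entries_dvd 3 (shear e m - 1)"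
proof -
  have "3 dvd [:0, 3 * e:]"
    by (rule dvdI[of _ _ "[:0, e:]"]) (simp add: numeral_poly)
  then show ?thesis
    by (simp add: entries_dvd_def shear_def Let_def mat2_defs del: mult_pCons_left mult_pCons_right)
qed

definition exponent :: "nat \<times> bool \<Rightarrow> int" where
  "exponent l = (if snd l then 1 else - 1)"

text \<open>A letter is sent to a product of two transvections, and not to a single one, because a generator would
  otherwise have trace \<open>2\<close>.  The slopes are those of the letter and of its inverse, so that two
  consecutive letters \<open>l l'\<close> have equal slopes at their junction only if \<open>l'\<close> is inverse to \<open>l\<close>.\<close>

definition letter_matrix :: "nat \<times> bool \<Rightarrow> int poly mat2" where
  "letter_matrix l =
    shear (exponent l) (slope l) * shear (exponent l) (slope (inv_letter l))"

lemma letter_matrix_inverse: "letter_matrix l * letter_matrix (inv_letter l) = 1"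
proof -
  let ?e = "exponent l"
  let ?p = "slope l" and ?q = "slope (inv_letter l)"
  have "letter_matrix l * letter_matrix (inv_letter l)
      = shear ?e ?p * (shear ?e ?q * shear (- ?e) ?q) * shear (- ?e) ?p"
    by (simp add: letter_matrix_def exponent_def inv_letter_def mult.assoc)
  then show ?thesis by (simp add: shear_inverse)
qed

lemma entries_dvd_letter_matrix: "entries_dvd 3 (letter_matrix l - 1)"
  by (simp add: letter_matrix_def entries_dvd_mult_one entries_dvd_shear)

lemma mat_leading_letter_matrix:
  assumes "p = slope l" "q = slope (inv_letter l)"
  shows "mat_leading 2 (letter_matrix l)
    (Mat2 (- (9 * (q - p)) * q) (9 * (q - p)) (- (9 * (q - p)) * p * q) (9 * (q - p) * p))"
proof -
  define e where "e = exponent l"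
  have e: "e * e = 1" by (simp add: e_def exponent_def)
  have "letter_matrix l = shear e p * shear e q"
    by (simp add: letter_matrix_def assms e_def)
  with mat_leading_mult[OF mat_leading_shear[of e p] mat_leading_shear[of e q]]
  have "mat_leading 2 (letter_matrix l)
    (Mat2 (- 3 * e * p) (3 * e) (- 3 * e * p\<^sup>2) (3 * e * p) *
     Mat2 (- 3 * e * q) (3 * e) (- 3 * e * q\<^sup>2) (3 * e * q))"
    by (simp only: one_add_one)
  moreover have "Mat2 (- 3 * e * p) (3 * e) (- 3 * e * p\<^sup>2) (3 * e * p) *
     Mat2 (- 3 * e * q) (3 * e) (- 3 * e * q\<^sup>2) (3 * e * q) =
     Mat2 (- (9 * (q - p)) * q * (e * e)) (9 * (q - p) * (e * e))
       (- (9 * (q - p)) * p * q * (e * e)) (9 * (q - p) * p * (e * e))"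
    by (simp add: times_mat2_def power2_eq_square algebra_simps)
  ultimately show ?thesis by (simp add: e)
qed

definition word_matrix :: "(nat \<times> bool) list \<Rightarrow> int poly mat2" where
  "word_matrix w = prod_list (map letter_matrix w)"

lemma word_matrix_simps [simp]:
  "word_matrix [] = 1"
  "word_matrix (l # w) = letter_matrix l * word_matrix w"
  "word_matrix (u @ w) = word_matrix u * word_matrix w"
  by (simp_all add: word_matrix_def)

lemma word_matrix_push_letter: "word_matrix (push_letter l w) = letter_matrix l * word_matrix w"
proof (cases w)
  case (Cons l' w')
  then show ?thesis
    by (auto simp flip: mult.assoc simp: letter_matrix_inverse)
qed simp

lemma word_matrix_mult_hom: "mult_hom (free_group S) word_matrix"
proof -
  have "word_matrix (foldr push_letter u v) = word_matrix u * word_matrix v" for u v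
    by (induction u) (simp_all add: word_matrix_push_letter mult.assoc)
  then show ?thesis by (simp add: mult_hom_def free_group_def)
qed

lemma entries_dvd_word_matrix: "entries_dvd 3 (word_matrix w - 1)"
proof (induction w)
  case Nil
  show ?case by (simp add: entries_dvd_zero)
next
  case (Cons l w)
  then show ?case by (simp add: entries_dvd_mult_one entries_dvd_letter_matrix)
qed

text \<open>The coefficient of top degree is a multiple of the rank one matrix formed from the first and the last
  slope.  The scalar \<open>c\<close> collects factors \<open>9\<close> and differences of adjacent slopes, none of which is
  \<open>0\<close> in a reduced word.\<close>

lemma mat_leading_word_matrix:
  assumes "reduced_word w" "w \<noteq> []"
  defines "p \<equiv> slope (hd w)" and "q \<equiv> slope (inv_letter (last w))"
  shows "\<exists>c. c \<noteq> 0 \<and>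
    mat_leading (2 * length w) (word_matrix w) (Mat2 (- c * q) c (- c * p * q) (c * p))"
  using assms(1,2) unfolding p_def q_def
proof (induction w)
  case (Cons l w)
  let ?p = "slope l" and ?q = "slope (inv_letter l)"
  have d: "9 * (?q - ?p) \<noteq> 0" by (simp add: slope_eq_iff)
  note l = mat_leading_letter_matrix[OF refl refl, of l]
  show ?case
  proof (cases "w = []")
    case True
    with d l show ?thesis by (intro exI[of _ "9 * (?q - ?p)"]) simp
  next
    case False
    let ?p' = "slope (hd w)" and ?q' = "slope (inv_letter (last w))"
    obtain c where c: "c \<noteq> 0"
      "mat_leading (2 * length w) (word_matrix w) (Mat2 (- c * ?q') c (- c * ?p' * ?q') (c * ?p'))"
      using Cons False reduced_word_ConsD by blast
    have "hd w \<noteq> inv_letter l"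
      using Cons.prems False by (cases w) (auto simp: reduced_word_def)
    then have "?p' - ?q \<noteq> 0" by (simp add: slope_eq_iff)
    let ?c = "9 * (?q - ?p) * (?p' - ?q) * c"
    have "Mat2 (- (9 * (?q - ?p)) * ?q) (9 * (?q - ?p)) (- (9 * (?q - ?p)) * ?p * ?q) (9 * (?q - ?p) * ?p)
        * Mat2 (- c * ?q') c (- c * ?p' * ?q') (c * ?p')
      = Mat2 (- ?c * ?q') ?c (- ?c * ?p * ?q') (?c * ?p)"
      by (simp add: times_mat2_def algebra_simps)
    then have "mat_leading (2 * length (l # w)) (word_matrix (l # w))
        (Mat2 (- ?c * ?q') ?c (- ?c * ?p * ?q') (?c * ?p))"
      using mat_leading_mult[OF l c(2)] by simp
    moreover have "?c \<noteq> 0" using d c(1) \<open>?p' - ?q \<noteq> 0\<close> by simp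
    ultimately show ?thesis using False by (intro exI[of _ ?c]) simp
  qed
qed simp

lemma word_matrix_lower_left:
  assumes "reduced_word w" "w \<noteq> []"
  shows "m21 (word_matrix w) \<noteq> 0"
proof
  assume "m21 (word_matrix w) = 0"
  moreover obtain c where c: "c \<noteq> 0"
    "mat_leading (2 * length w) (word_matrix w)
      (Mat2 (- c * slope (inv_letter (last w))) c
        (- c * slope (hd w) * slope (inv_letter (last w))) (c * slope (hd w)))"
    using mat_leading_word_matrix[OF assms] by blast
  ultimately have "c * slope (hd w) * slope (inv_letter (last w)) = 0"
    by (simp add: mat_leading_def leading_def)
  then show False using c(1) slope_pos[of "hd w"] slope_pos[of "inv_letter (last w)"] by simp
qed

text \<open>For a cyclically reduced word the first and the last slope differ, and the trace has positive degree.
  The general case follows by cyclic reduction, which leaves the trace unchanged.\<close>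

lemma trace_word_matrix:
  assumes "reduced_word w" "w \<noteq> []"
  shows "trace (word_matrix w) \<noteq> 2"
  using assms
proof (induction w rule: length_induct)
  case (1 w)
  show ?case
  proof (cases "hd w = inv_letter (last w)")
    case False
    obtain c where c: "c \<noteq> 0"
      "mat_leading (2 * length w) (word_matrix w)
        (Mat2 (- c * slope (inv_letter (last w))) c
          (- c * slope (hd w) * slope (inv_letter (last w))) (c * slope (hd w)))"
      using mat_leading_word_matrix[OF 1(2,3)] by blast
    have "leading (2 * length w) (trace (word_matrix w))
        (c * (slope (hd w) - slope (inv_letter (last w))))"
      using mat_leading_trace[OF c(2)] by (simp add: trace_def algebra_simps)
    then have "coeff (trace (word_matrix w)) (2 * length w) \<noteq> 0"
      using False c(1) by (simp add: leading_def slope_eq_iff)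
    moreover have "coeff (2 :: int poly) (2 * length w) = 0"
      using 1(3) by (intro coeff_eq_0) simp
    ultimately show ?thesis by metis
  next
    case True
    obtain l v where w: "w = l # v" using 1(3) by (cases w) auto
    have "v \<noteq> []" using True w by auto
    then obtain u where v: "v = u @ [inv_letter l]"
      using True w by (metis append_butlast_last_id inv_letter_inv_letter last_ConsR list.sel(1))
    have "u \<noteq> []" "reduced_word u"
      using 1(2) w v by (auto simp: reduced_word_def successively_Cons successively_append_iff)
    then have "trace (word_matrix u) \<noteq> 2" using 1(1) w v by simp
    moreover have "trace (word_matrix w) = trace (word_matrix u * (letter_matrix (inv_letter l) * letter_matrix l))"
      by (simp add: w v trace_commute[of "letter_matrix l"] mult.assoc)
    ultimately show ?thesis
      using letter_matrix_inverse[of "inv_letter l"] by simp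
  qed
qed

definition const_mat :: "'a::comm_ring_1 mat2 \<Rightarrow> 'a poly mat2" where
  "const_mat X = Mat2 [:m11 X:] [:m12 X:] [:m21 X:] [:m22 X:]"

text \<open>Conjugation by the upper unitriangular matrix whose entry is the new indeterminate \<open>u\<close>.  The
  coefficient of \<open>u\<^sup>2\<close> in the result is, up to sign, a matrix unit times the lower left entry of the given matrix.\<close>

definition sheared_mat :: "'a::comm_ring_1 mat2 \<Rightarrow> 'a poly mat2" where
  "sheared_mat X = Mat2 1 [:0, 1:] 0 1 * const_mat X * Mat2 1 [:0, -1:] 0 1"

lemma const_mat_one: "const_mat 1 = 1"
  by (simp add: const_mat_def one_mat2_def one_pCons)

lemma const_mat_mult: "const_mat (X * Y) = const_mat X * const_mat Y"
  by (simp add: const_mat_def times_mat2_def)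

lemma shear_cancel: "Mat2 1 [:0, -1:] 0 1 * Mat2 1 [:0, 1:] 0 1 = (1 :: 'a::comm_ring_1 poly mat2)"
  "Mat2 1 [:0, 1:] 0 1 * Mat2 1 [:0, -1:] 0 1 = (1 :: 'a::comm_ring_1 poly mat2)"
  by (simp_all add: mat2_defs)

lemma sheared_mat_one: "sheared_mat 1 = 1"
  by (simp add: sheared_mat_def const_mat_one shear_cancel)

lemma sheared_mat_mult: "sheared_mat (X * Y) = sheared_mat X * sheared_mat Y"
proof -
  have "sheared_mat X * sheared_mat Y = Mat2 1 [:0, 1:] 0 1 * const_mat X *
      (Mat2 1 [:0, -1:] 0 1 * Mat2 1 [:0, 1:] 0 1) * const_mat Y * Mat2 1 [:0, -1:] 0 1"
    by (simp only: sheared_mat_def mult.assoc)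
  then show ?thesis
    by (simp add: shear_cancel sheared_mat_def const_mat_mult mult.assoc)
qed

lemma entries_dvd_const_mat:
  assumes "entries_dvd 3 (X - 1)"
  shows "entries_dvd 3 (const_mat X - 1)"
proof -
  have "3 dvd [:c:]" if "3 dvd c" for c :: 'a
  proof -
    from that obtain b where "c = 3 * b" by (rule dvdE)
    then have "[:c:] = 3 * [:b:]" by (simp add: numeral_poly)
    then show ?thesis by (rule dvdI)
  qed
  moreover have "const_mat X - 1 = const_mat (X - 1)"
    by (simp add: const_mat_def mat2_defs one_pCons)
  ultimately show ?thesis
    using assms by (simp add: entries_dvd_def const_mat_def)
qed

lemma entries_dvd_sheared_mat:
  assumes "entries_dvd 3 (X - 1)"
  shows "entries_dvd 3 (sheared_mat X - 1)"
proof -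
  have "sheared_mat X - 1 = Mat2 1 [:0, 1:] 0 1 * (const_mat X - 1) * Mat2 1 [:0, -1:] 0 1"
    by (simp add: sheared_mat_def algebra_simps shear_cancel)
  then show ?thesis using entries_dvd_conj[OF entries_dvd_const_mat[OF assms]] by simp
qed

lemma mat_leading_const_mat: "mat_leading 0 (const_mat X) X"
  by (simp add: mat_leading_def leading_def const_mat_def)

lemma mat_leading_sheared_mat: "mat_leading 2 (sheared_mat X) (Mat2 0 (- m21 X) 0 0)"
  by (simp add: mat_leading_def leading_def sheared_mat_def const_mat_def times_mat2_def
    numeral_2_eq_2 one_pCons)

lemma trace_const_mat: "trace (const_mat X) = [:trace X:]"
  by (simp add: trace_def const_mat_def)

section \<open>Homomorphisms on an internal free product\<close>

context group
begin

lemma word_product_closed: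
  assumes "\<And>i. i \<in> I \<Longrightarrow> subgroup (H i) G" "w \<in> free_product_words G I H"
  shows "word_product G w \<in> carrier G"
proof -
  have "\<forall>(i, a)\<in>set w. a \<in> carrier G"
    using assms subgroup.mem_carrier by (fastforce simp: free_product_words_def)
  then show ?thesis by (induction w) (auto simp: word_product_def)
qed

text \<open>The homomorphism is evaluated on normal forms.  It is multiplicative because left multiplication of a
  normal form by a syllable \<open>a\<close> from the factor \<open>i\<close> changes only its first syllable, compatibly with
  evaluation.\<close>

lemma internal_free_product_extend:
  fixes \<phi> :: "'i \<Rightarrow> 'a \<Rightarrow> 'k::monoid_mult"
  assumes free: "internal_free_product G I H"
    and one: "\<And>i. i \<in> I \<Longrightarrow> \<phi> i \<one> = 1"
    and mult: "\<And>i x y. i \<in> I \<Longrightarrow> x \<in> H i \<Longrightarrow> y \<in> H i \<Longrightarrow> \<phi> i (x \<otimes> y) = \<phi> i x * \<phi> i y"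
  shows "\<exists>\<rho>. mult_hom G \<rho> \<and> (\<forall>i\<in>I. \<forall>x\<in>H i. \<rho> x = \<phi> i x)"
proof -
  let ?W = "free_product_words G I H"
  define ev where "ev w = foldr (\<lambda>(i, a) x. \<phi> i a * x) w 1" for w
  define \<rho> where "\<rho> g = ev (inv_into ?W (word_product G) g)" for g
  have sub: "subgroup (H i) G" if "i \<in> I" for i
    using free that by (simp add: internal_free_product_def)
  have bij: "bij_betw (word_product G) ?W (carrier G)"
    using free by (simp add: internal_free_product_def)
  have \<rho>_word: "\<rho> (word_product G w) = ev w" if "w \<in> ?W" for w
    using that bij by (simp add: \<rho>_def bij_betw_def)
  have word: "\<exists>w\<in>?W. word_product G w = g" if "g \<in> carrier G" for g
    using bij_betw_imp_surj_on[OF bij] that by (metis imageE)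
  have carr: "a \<in> carrier G" if "i \<in> I" "a \<in> H i" for i a
    by (rule subgroup.mem_carrier[OF sub[OF that(1)] that(2)])
  have push: "\<exists>w'\<in>?W. word_product G w' = a \<otimes> word_product G w \<and> ev w' = \<phi> i a * ev w"
    if i: "i \<in> I" and a: "a \<in> H i" and w: "w \<in> ?W" for i a w
  proof -
    have wc: "word_product G w \<in> carrier G" using word_product_closed[OF sub w] .
    consider "a = \<one>" | "a \<noteq> \<one>" "w = []" | j b v where "a \<noteq> \<one>" "w = (j, b) # v" "j \<noteq> i"
      | b v where "a \<noteq> \<one>" "w = (i, b) # v" "a \<otimes> b = \<one>"
      | b v where "a \<noteq> \<one>" "w = (i, b) # v" "a \<otimes> b \<noteq> \<one>"
      by (metis list.exhaust surj_pair)
    then show ?thesis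
    proof cases
      case 1
      then show ?thesis using w wc one[OF i] by auto
    next
      case 2
      then have "[(i, a)] \<in> ?W" using i a by (simp add: free_product_words_def)
      moreover have "word_product G [(i, a)] = a \<otimes> word_product G w" "ev [(i, a)] = \<phi> i a * ev w"
        using 2 by (simp_all add: word_product_def ev_def)
      ultimately show ?thesis by blast
    next
      case 3
      then have "(i, a) # w \<in> ?W" using i a w by (auto simp: free_product_words_def)
      moreover have "word_product G ((i, a) # w) = a \<otimes> word_product G w"
        "ev ((i, a) # w) = \<phi> i a * ev w"
        by (simp_all add: word_product_def ev_def)
      ultimately show ?thesis by blast
    next
      case 4
      have b: "b \<in> H i" and v: "v \<in> ?W"
        using w 4 by (auto simp: free_product_words_def successively_Cons)
      have vc: "word_product G v \<in> carrier G" using word_product_closed[OF sub v] .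
      have "a \<otimes> word_product G w = (a \<otimes> b) \<otimes> word_product G v"
        using carr[OF i a] carr[OF i b] vc 4(2) by (simp add: word_product_def m_assoc)
      moreover have "\<phi> i a * ev w = \<phi> i (a \<otimes> b) * ev v"
        using 4(2) mult[OF i a b] by (simp add: ev_def mult.assoc)
      ultimately show ?thesis using v vc 4(3) one[OF i] by auto
    next
      case 5
      have b: "b \<in> H i" and v: "v \<in> ?W"
        using w 5 by (auto simp: free_product_words_def successively_Cons)
      have vc: "word_product G v \<in> carrier G" using word_product_closed[OF sub v] .
      have "a \<otimes> b \<in> H i" using sub[OF i] a b by (rule subgroup.m_closed)
      then have "(i, a \<otimes> b) # v \<in> ?W"
        using w 5 i by (auto simp: free_product_words_def successively_Cons)
      moreover have "word_product G ((i, a \<otimes> b) # v) = a \<otimes> word_product G w"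
        using carr[OF i a] carr[OF i b] vc 5(2) by (simp add: word_product_def m_assoc)
      moreover have "ev ((i, a \<otimes> b) # v) = \<phi> i a * ev w"
        using 5(2) mult[OF i a b] by (simp add: ev_def mult.assoc)
      ultimately show ?thesis by blast
    qed
  qed
  have \<rho>_factor_mult: "\<rho> (a \<otimes> g) = \<phi> i a * \<rho> g" if "i \<in> I" "a \<in> H i" "g \<in> carrier G" for i a g
    using word[OF that(3)] push[OF that(1,2)] \<rho>_word by metis
  have \<rho>_one: "\<rho> \<one> = 1"
  proof -
    have "[] \<in> ?W" by (simp add: free_product_words_def)
    from \<rho>_word[OF this] show ?thesis by (simp add: word_product_def ev_def)
  qed
  have \<rho>_factor: "\<rho> a = \<phi> i a" if "i \<in> I" "a \<in> H i" for i a
    using \<rho>_factor_mult[OF that one_closed] carr[OF that] \<rho>_one by simp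
  have \<rho>_word_mult: "word_product G w \<in> carrier G \<and> \<rho> (word_product G w \<otimes> g) = ev w * \<rho> g"
    if "\<forall>(i, a)\<in>set w. i \<in> I \<and> a \<in> H i" "g \<in> carrier G" for w g
    using that(1)
  proof (induction w)
    case Nil
    then show ?case using that(2) by (simp add: word_product_def ev_def)
  next
    case (Cons s w)
    obtain i a where s: "s = (i, a)" by (cases s)
    have ia: "i \<in> I" "a \<in> H i" and IH: "word_product G w \<in> carrier G"
      "\<rho> (word_product G w \<otimes> g) = ev w * \<rho> g"
      using Cons s by auto
    have "word_product G (s # w) = a \<otimes> word_product G w" "ev (s # w) = \<phi> i a * ev w"
      by (simp_all add: s word_product_def ev_def)
    then show ?case
      using IH \<rho>_factor_mult[OF ia, of "word_product G w \<otimes> g"] carr[OF ia] that(2)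
      by (simp add: m_assoc mult.assoc)
  qed
  have "\<rho> (h \<otimes> g) = \<rho> h * \<rho> g" if "h \<in> carrier G" "g \<in> carrier G" for h g
  proof -
    from word[OF that(1)] obtain w where w: "w \<in> ?W" "word_product G w = h" by blast
    have "\<forall>(i, a)\<in>set w. i \<in> I \<and> a \<in> H i" using w(1) by (auto simp: free_product_words_def)
    then show ?thesis using \<rho>_word_mult[OF _ that(2), of w] \<rho>_word[OF w(1)] w(2) by simp
  qed
  then show ?thesis using \<rho>_one \<rho>_factor by (auto simp: mult_hom_def)
qed

lemma internal_free_product_induct:
  assumes free: "internal_free_product G I H" and g: "g \<in> carrier G"
    and one: "P \<one>"
    and step: "\<And>i x g. i \<in> I \<Longrightarrow> x \<in> H i \<Longrightarrow> g \<in> carrier G \<Longrightarrow> P g \<Longrightarrow> P (x \<otimes> g)"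
  shows "P g"
proof -
  have sub: "subgroup (H i) G" if "i \<in> I" for i
    using free that by (simp add: internal_free_product_def)
  obtain w where w: "w \<in> free_product_words G I H" "word_product G w = g"
    using free g unfolding internal_free_product_def by (metis bij_betw_imp_surj_on imageE)
  have "\<forall>(i, a)\<in>set w. i \<in> I \<and> a \<in> H i" using w(1) by (auto simp: free_product_words_def)
  then have "word_product G w \<in> carrier G \<and> P (word_product G w)"
  proof (induction w)
    case (Cons s w)
    obtain i a where s: "s = (i, a)" by (cases s)
    have "a \<in> carrier G" using Cons.prems s sub subgroup.mem_carrier by fastforce
    then show ?case
      using Cons step[of i a "word_product G w"] by (auto simp: s word_product_def)
  qed (simp add: word_product_def one)
  then show ?thesis using w(2) by simp
qed

definition conjugate :: "'a \<Rightarrow> 'a \<Rightarrow> bool" where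
  "conjugate x y \<longleftrightarrow> (\<exists>g\<in>carrier G. y = g \<otimes> x \<otimes> inv g)"

lemma conjugate_trans: "conjugate x y \<Longrightarrow> conjugate y z \<Longrightarrow> x \<in> carrier G \<Longrightarrow> conjugate x z"
proof -
  assume "conjugate x y" "conjugate y z" and x: "x \<in> carrier G"
  then obtain g h where gh: "g \<in> carrier G" "h \<in> carrier G"
    "y = g \<otimes> x \<otimes> inv g" "z = h \<otimes> y \<otimes> inv h"
    unfolding conjugate_def by blast
  have "z = (h \<otimes> g) \<otimes> x \<otimes> inv (h \<otimes> g)"
    using gh x by (simp add: m_assoc inv_mult_group)
  then show ?thesis using gh unfolding conjugate_def by blast
qed

lemma conjugate_refl: "x \<in> carrier G \<Longrightarrow> conjugate x x"
  unfolding conjugate_def by (intro bexI[of _ \<one>]) simp_all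

lemma conjugate_swap: "x \<in> carrier G \<Longrightarrow> y \<in> carrier G \<Longrightarrow> conjugate (x \<otimes> y) (y \<otimes> x)"
  unfolding conjugate_def by (intro bexI[of _ y]) (simp_all add: m_assoc)

lemma class_function_conjugate:
  "class_function G f \<Longrightarrow> conjugate x y \<Longrightarrow> x \<in> carrier G \<Longrightarrow> f y = f x"
  by (auto simp: class_function_def conjugate_def)

end

section \<open>Splittings as a free product of two factors\<close>

text \<open>Of a decomposition \<open>G = A * B\<close> only generation and the extension of homomorphisms are recorded.
  Extension is stated for the values that occur, matrices of polynomials, and for homomorphisms
  \<open>\<phi>\<close> and \<open>\<phi>'\<close> that are defined on all of \<open>G\<close>.  The last two assumptions on \<open>\<sigma>\<close>, strong forms
  of faithfulness, let traces tell elements of \<open>G\<close> apart.\<close>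

locale free_splitting = group G for G (structure) +
  fixes A B :: "'a set" and \<sigma> :: "'a \<Rightarrow> 'r::three_separated mat2"
  assumes A: "subgroup A G" and B: "subgroup B G"
    and splitting_induct: "g \<in> carrier G \<Longrightarrow> P \<one> \<Longrightarrow>
      (\<And>x g. x \<in> A \<union> B \<Longrightarrow> g \<in> carrier G \<Longrightarrow> P g \<Longrightarrow> P (x \<otimes> g)) \<Longrightarrow> P g"
    and extend: "mult_hom G \<phi> \<Longrightarrow> mult_hom G \<phi>' \<Longrightarrow>
      \<exists>\<rho> :: 'a \<Rightarrow> 'r poly mat2. mult_hom G \<rho> \<and> (\<forall>x\<in>A. \<rho> x = \<phi> x) \<and> (\<forall>x\<in>B. \<rho> x = \<phi>' x)"
    and \<sigma>: "mult_hom G \<sigma>"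
    and \<sigma>_three: "g \<in> carrier G \<Longrightarrow> entries_dvd 3 (\<sigma> g - 1)"
    and \<sigma>_lower_left: "g \<in> carrier G \<Longrightarrow> g \<noteq> \<one> \<Longrightarrow> m21 (\<sigma> g) \<noteq> 0"
    and \<sigma>_trace: "g \<in> carrier G \<Longrightarrow> g \<noteq> \<one> \<Longrightarrow> trace (\<sigma> g) \<noteq> 2"
begin

lemma A_carrier [simp]: "a \<in> A \<Longrightarrow> a \<in> carrier G"
  using A by (rule subgroup.mem_carrier)

lemma B_carrier [simp]: "b \<in> B \<Longrightarrow> b \<in> carrier G"
  using B by (rule subgroup.mem_carrier)

lemma A_closed [simp]: "\<one> \<in> A" "a \<in> A \<Longrightarrow> a' \<in> A \<Longrightarrow> a \<otimes> a' \<in> A" "a \<in> A \<Longrightarrow> inv a \<in> A"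
  using A by (simp_all add: subgroup.one_closed subgroup.m_closed subgroup.m_inv_closed)

lemma B_closed [simp]: "\<one> \<in> B" "b \<in> B \<Longrightarrow> b' \<in> B \<Longrightarrow> b \<otimes> b' \<in> B" "b \<in> B \<Longrightarrow> inv b \<in> B"
  using B by (simp_all add: subgroup.one_closed subgroup.m_closed subgroup.m_inv_closed)

text \<open>The products \<open>b\<^sub>0 a\<^sub>1 b\<^sub>1 \<cdots> a\<^sub>s b\<^sub>s\<close> of nontrivial syllables, which begin and end in
  \<open>B\<close>.\<close>

fun alternating :: "nat \<Rightarrow> 'a set" where
  "alternating 0 = B - {\<one>}"
| "alternating (Suc s) = {b \<otimes> a \<otimes> t | b a t. b \<in> B - {\<one>} \<and> a \<in> A - {\<one>} \<and> t \<in> alternating s}"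

lemma alternating_carrier [simp]: "t \<in> alternating s \<Longrightarrow> t \<in> carrier G"
  by (induction s arbitrary: t) auto

lemma alternating_SucE:
  assumes "t \<in> alternating (Suc s)"
  obtains b a t' where "b \<in> B" "b \<noteq> \<one>" "a \<in> A" "a \<noteq> \<one>" "t' \<in> alternating s" "t = b \<otimes> a \<otimes> t'"
  using assms by auto

lemma alternating_SucI:
  "b \<in> B \<Longrightarrow> b \<noteq> \<one> \<Longrightarrow> a \<in> A \<Longrightarrow> a \<noteq> \<one> \<Longrightarrow> t \<in> alternating s \<Longrightarrow> b \<otimes> a \<otimes> t \<in> alternating (Suc s)"
  by auto

declare alternating.simps(2) [simp del]

lemma alternating_join:
  assumes "t \<in> alternating s" "a \<in> A" "a \<noteq> \<one>" "t' \<in> alternating r"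
  shows "t \<otimes> a \<otimes> t' \<in> alternating (Suc (s + r))"
  using assms(1)
proof (induction s arbitrary: t)
  case 0
  then show ?case using assms by (auto intro: alternating_SucI)
next
  case (Suc s)
  from Suc.prems obtain b a' u where u: "b \<in> B" "b \<noteq> \<one>" "a' \<in> A" "a' \<noteq> \<one>" "u \<in> alternating s"
    "t = b \<otimes> a' \<otimes> u"
    by (rule alternating_SucE)
  have "b \<otimes> a' \<otimes> (u \<otimes> a \<otimes> t') \<in> alternating (Suc (Suc (s + r)))"
    by (rule alternating_SucI[OF u(1-4) Suc.IH[OF u(5)]])
  moreover have "b \<otimes> a' \<otimes> (u \<otimes> a \<otimes> t') = t \<otimes> a \<otimes> t'"
    using u assms by (simp add: m_assoc)
  ultimately show ?case by simp
qed

lemma alternating_inv: "t \<in> alternating s \<Longrightarrow> inv t \<in> alternating s"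
proof (induction s arbitrary: t)
  case (Suc s)
  from Suc.prems obtain b a u where u: "b \<in> B" "b \<noteq> \<one>" "a \<in> A" "a \<noteq> \<one>" "u \<in> alternating s"
    "t = b \<otimes> a \<otimes> u"
    by (rule alternating_SucE)
  have "inv u \<otimes> inv a \<otimes> inv b \<in> alternating (Suc (s + 0))"
    using u Suc.IH by (intro alternating_join) (auto simp: inv_eq_1_iff)
  moreover have "inv t = inv u \<otimes> inv a \<otimes> inv b"
    using u by (simp add: inv_mult_group m_assoc)
  ultimately show ?case by simp
qed (auto simp: inv_eq_1_iff)

lemma alternating_Suc_snocE:
  assumes "t \<in> alternating (Suc s)"
  obtains t' a b where "t' \<in> alternating s" "a \<in> A" "a \<noteq> \<one>" "b \<in> B" "b \<noteq> \<one>" "t = t' \<otimes> a \<otimes> b"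
proof -
  from alternating_inv[OF assms] obtain b a u
    where u: "b \<in> B" "b \<noteq> \<one>" "a \<in> A" "a \<noteq> \<one>" "u \<in> alternating s" "inv t = b \<otimes> a \<otimes> u"
    by (rule alternating_SucE)
  have "t = inv (inv t)" using assms by simp
  also have "\<dots> = inv u \<otimes> inv a \<otimes> inv b"
    using u by (simp add: inv_mult_group m_assoc)
  finally show thesis
    using u alternating_inv by (intro that[of "inv u" "inv a" "inv b"]) (auto simp: inv_eq_1_iff)
qed

text \<open>Up to conjugacy, the elements that involve both factors: their normal form is cyclically reduced.\<close>

definition mixed :: "'a set" where
  "mixed = {a \<otimes> t | a t s. a \<in> A - {\<one>} \<and> t \<in> alternating s}"

lemma mixedI: "a \<in> A \<Longrightarrow> a \<noteq> \<one> \<Longrightarrow> t \<in> alternating s \<Longrightarrow> a \<otimes> t \<in> mixed"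
  by (auto simp: mixed_def)

text \<open>The products that lie in \<open>A\<close> or have this form are stable under left multiplication by \<open>A\<close> and by \<open>B\<close>,
  since a factor from \<open>B\<close> only meets the first syllable or two.\<close>

lemma splitting_cases:
  assumes "g \<in> carrier G"
  obtains "g \<in> A" | a t a' s where "a \<in> A" "a' \<in> A" "t \<in> alternating s" "g = a \<otimes> t \<otimes> a'"
proof -
  let ?P = "\<lambda>g. g \<in> A \<or> (\<exists>a\<in>A. \<exists>a'\<in>A. \<exists>s. \<exists>t\<in>alternating s. g = a \<otimes> t \<otimes> a')"
  have "?P g"
  proof (rule splitting_induct[OF assms])
    fix x g
    assume x: "x \<in> A \<union> B" and g: "g \<in> carrier G" and P: "?P g"
    consider "x \<in> A" | "x \<in> B" "x \<noteq> \<one>" | "x = \<one>" using x by blast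
    then show "?P (x \<otimes> g)"
    proof cases
      case 1
      from P show ?thesis
      proof
        assume "\<exists>a\<in>A. \<exists>a'\<in>A. \<exists>s. \<exists>t\<in>alternating s. g = a \<otimes> t \<otimes> a'"
        then obtain a a' s t where a: "a \<in> A" "a' \<in> A" "t \<in> alternating s" "g = a \<otimes> t \<otimes> a'" by blast
        then have "x \<otimes> g = (x \<otimes> a) \<otimes> t \<otimes> a'" using 1 by (simp add: m_assoc)
        then show ?thesis using a 1 A_closed(2) by blast
      qed (use 1 in simp)
    next
      case 2
      have x0: "x \<in> alternating 0" using 2 by simp
      from P show ?thesis
      proof
        assume "g \<in> A"
        moreover have "x \<otimes> g = \<one> \<otimes> x \<otimes> g" using 2 by simp
        ultimately show ?thesis using x0 A_closed(1) by blast
      next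
        assume "\<exists>a\<in>A. \<exists>a'\<in>A. \<exists>s. \<exists>t\<in>alternating s. g = a \<otimes> t \<otimes> a'"
        then obtain a a' s t where a: "a \<in> A" "a' \<in> A" "t \<in> alternating s" "g = a \<otimes> t \<otimes> a'" by blast
        show ?thesis
        proof (cases "a = \<one>")
          case False
          then have "x \<otimes> a \<otimes> t \<in> alternating (Suc s)" using a 2 by (intro alternating_SucI)
          moreover have "x \<otimes> g = \<one> \<otimes> (x \<otimes> a \<otimes> t) \<otimes> a'" using a 2 by (simp add: m_assoc)
          ultimately show ?thesis using a A_closed(1) by blast
        next
          case a1: True
          show ?thesis
          proof (cases s)
            case 0
            then have t: "t \<in> B" using a by simp
            have xg: "x \<otimes> g = \<one> \<otimes> (x \<otimes> t) \<otimes> a'" using a a1 2 by (simp add: m_assoc)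
            show ?thesis
            proof (cases "x \<otimes> t = \<one>")
              case True
              then show ?thesis using xg a by simp
            next
              case False
              then have "x \<otimes> t \<in> alternating 0" using t 2 by simp
              then show ?thesis using xg a A_closed(1) by blast
            qed
          next
            case (Suc r)
            then obtain b c u where u: "b \<in> B" "b \<noteq> \<one>" "c \<in> A" "c \<noteq> \<one>" "u \<in> alternating r"
              "t = b \<otimes> c \<otimes> u"
              using a alternating_SucE by metis
            show ?thesis
            proof (cases "x \<otimes> b = \<one>")
              case True
              have "x \<otimes> g = (x \<otimes> b) \<otimes> c \<otimes> u \<otimes> a'" using a a1 u 2 by (simp add: m_assoc)
              then have "x \<otimes> g = c \<otimes> u \<otimes> a'" using True u by simp
              then show ?thesis using u a by blast
            next
              case False
              then have "(x \<otimes> b) \<otimes> c \<otimes> u \<in> alternating (Suc r)"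
                using u 2 by (intro alternating_SucI) simp_all
              moreover have "x \<otimes> g = \<one> \<otimes> ((x \<otimes> b) \<otimes> c \<otimes> u) \<otimes> a'"
                using a a1 u 2 by (simp add: m_assoc)
              ultimately show ?thesis using a A_closed(1) by blast
            qed
          qed
        qed
      qed
    next
      case 3
      then show ?thesis using P g by simp
    qed
  qed simp
  then show thesis using that by blast
qed

text \<open>If the first and the last syllable cancel cyclically, then the two syllables of \<open>A\<close> next to them become
  adjacent, and the number of syllables drops.\<close>

lemma alternating_conjugate_cases:
  "t \<in> alternating s \<Longrightarrow> \<exists>y\<in>A \<union> B \<union> mixed. conjugate t y"
proof (induction s arbitrary: t rule: less_induct)
  case (less s)
  show ?case
  proof (cases s)
    case 0
    then have "t \<in> B" using less.prems by simp
    then show ?thesis using conjugate_refl[of t] by auto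
  next
    case (Suc r)
    then obtain t' a b where t': "t' \<in> alternating r" "a \<in> A" "a \<noteq> \<one>" "b \<in> B" "b \<noteq> \<one>"
      "t = t' \<otimes> a \<otimes> b"
      using less.prems alternating_Suc_snocE by metis
    have t: "conjugate t (b \<otimes> (t' \<otimes> a))"
      using conjugate_swap[of "t' \<otimes> a" b] t' by simp
    have tc: "t \<in> carrier G" using less.prems by simp
    show ?thesis
    proof (cases r)
      case 0
      then have t'B: "t' \<in> B" using t' by simp
      show ?thesis
      proof (cases "b \<otimes> t' = \<one>")
        case True
        have "b \<otimes> (t' \<otimes> a) = (b \<otimes> t') \<otimes> a" using t' by (simp add: m_assoc)
        then show ?thesis using t True t' by auto
      next
        case False
        then have "a \<otimes> (b \<otimes> t') \<in> mixed" using t' t'B by (intro mixedI[of _ _ 0]) auto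
        moreover have "conjugate (b \<otimes> (t' \<otimes> a)) (a \<otimes> (b \<otimes> t'))"
          using conjugate_swap[of "b \<otimes> t'" a] t' by (simp add: m_assoc)
        ultimately show ?thesis using conjugate_trans[OF t _ tc] by blast
      qed
    next
      case (Suc q)
      then obtain b1 a1 u where u: "b1 \<in> B" "b1 \<noteq> \<one>" "a1 \<in> A" "a1 \<noteq> \<one>" "u \<in> alternating q"
        "t' = b1 \<otimes> a1 \<otimes> u"
        using t' alternating_SucE by metis
      show ?thesis
      proof (cases "b \<otimes> b1 = \<one>")
        case False
        then have "(b \<otimes> b1) \<otimes> a1 \<otimes> u \<in> alternating (Suc q)"
          using u t' by (intro alternating_SucI) simp_all
        then have "a \<otimes> ((b \<otimes> b1) \<otimes> a1 \<otimes> u) \<in> mixed" using t' by (intro mixedI)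
        moreover have "conjugate (b \<otimes> (t' \<otimes> a)) (a \<otimes> ((b \<otimes> b1) \<otimes> a1 \<otimes> u))"
          using conjugate_swap[of "(b \<otimes> b1) \<otimes> a1 \<otimes> u" a] t' u by (simp add: m_assoc)
        ultimately show ?thesis using conjugate_trans[OF t _ tc] by blast
      next
        case True
        have "b \<otimes> (t' \<otimes> a) = (b \<otimes> b1) \<otimes> (a1 \<otimes> u \<otimes> a)" using t' u by (simp add: m_assoc)
        then have "b \<otimes> (t' \<otimes> a) = (a1 \<otimes> u) \<otimes> a" using True t' u by simp
        moreover have "conjugate ((a1 \<otimes> u) \<otimes> a) ((a \<otimes> a1) \<otimes> u)"
          using conjugate_swap[of "a1 \<otimes> u" a] t' u by (simp add: m_assoc)
        ultimately have c: "conjugate t ((a \<otimes> a1) \<otimes> u)"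
          using conjugate_trans[OF t _ tc] by simp
        show ?thesis
        proof (cases "a \<otimes> a1 = \<one>")
          case True
          then have "conjugate t u" using c u by simp
          moreover obtain y where "y \<in> A \<union> B \<union> mixed" "conjugate u y"
            using less.IH[of q u] u \<open>s = Suc r\<close> Suc by auto
          ultimately show ?thesis using conjugate_trans[OF _ _ tc] by blast
        next
          case False
          then have "(a \<otimes> a1) \<otimes> u \<in> mixed" using t' u by (intro mixedI) simp_all
          then show ?thesis using c by blast
        qed
      qed
    qed
  qed
qed

lemma conjugate_cases:
  assumes "g \<in> carrier G"
  shows "\<exists>y\<in>A \<union> B \<union> mixed. conjugate g y"
  using assms
proof (cases rule: splitting_cases)
  case 1
  then show ?thesis using conjugate_refl[of g] by auto
next
  case (2 a t a' s)
  have c: "conjugate g ((a' \<otimes> a) \<otimes> t)"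
    using conjugate_swap[of "a \<otimes> t" a'] 2 by (simp add: m_assoc)
  show ?thesis
  proof (cases "a' \<otimes> a = \<one>")
    case True
    then have "conjugate g t" using c 2 by simp
    then show ?thesis
      using alternating_conjugate_cases[OF 2(3)] conjugate_trans[OF _ _ assms] by blast
  next
    case False
    then have "(a' \<otimes> a) \<otimes> t \<in> mixed" using 2 by (intro mixedI) simp_all
    then show ?thesis using c by blast
  qed
qed

lemma entries_dvd_of_factors:
  assumes \<rho>: "mult_hom G (\<rho> :: 'a \<Rightarrow> 'k::comm_ring_1 mat2)"
    and three: "\<And>x. x \<in> A \<union> B \<Longrightarrow> entries_dvd 3 (\<rho> x - 1)" and g: "g \<in> carrier G"
  shows "entries_dvd 3 (\<rho> g - 1)"
proof (rule splitting_induct[OF g])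
  show "entries_dvd 3 (\<rho> \<one> - 1)"
    using \<rho> by (simp add: mult_hom_def entries_dvd_zero)
  show "entries_dvd 3 (\<rho> (x \<otimes> g) - 1)"
    if "x \<in> A \<union> B" "g \<in> carrier G" "entries_dvd 3 (\<rho> g - 1)" for x g
  proof -
    have "\<rho> (x \<otimes> g) = \<rho> x * \<rho> g" using \<rho> that by (auto simp: mult_hom_def)
    then show ?thesis using that three by (simp add: entries_dvd_mult_one)
  qed
qed

lemma const_\<sigma>: "mult_hom G (\<lambda>g. const_mat (\<sigma> g))"
  using \<sigma> by (simp add: mult_hom_def const_mat_one const_mat_mult)

lemma sheared_\<sigma>: "mult_hom G (\<lambda>g. sheared_mat (\<sigma> g))"
  using \<sigma> by (simp add: mult_hom_def sheared_mat_one sheared_mat_mult)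

section \<open>Class functions that vanish on a factor\<close>

lemma detect_B:
  obtains f :: "'a \<Rightarrow> 'r poly" where "f \<in> filtered G 0" "class_function G f"
    "\<And>a. a \<in> A \<Longrightarrow> f a = 0" "\<And>b. b \<in> B \<Longrightarrow> b \<noteq> \<one> \<Longrightarrow> f b \<noteq> 0"
proof -
  have "mult_hom G (\<lambda>_. 1 :: 'r poly mat2)" by (simp add: mult_hom_def)
  from extend[OF this const_\<sigma>] obtain \<rho> :: "'a \<Rightarrow> 'r poly mat2" where \<rho>: "mult_hom G \<rho>"
    "\<And>x. x \<in> A \<Longrightarrow> \<rho> x = 1" "\<And>x. x \<in> B \<Longrightarrow> \<rho> x = const_mat (\<sigma> x)"
    by blast
  have "entries_dvd 3 (\<rho> x - 1)" if "x \<in> A \<union> B" for x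
    using that
  proof
    assume "x \<in> B"
    then show ?thesis
      using entries_dvd_const_mat[OF \<sigma>_three[of x]] by (simp add: \<rho>(3))
  qed (simp add: \<rho>(2) entries_dvd_zero)
  then have three: "entries_dvd 3 (\<rho> g - 1)" if "g \<in> carrier G" for g
    using entries_dvd_of_factors[OF \<rho>(1)] that by blast
  show thesis
  proof
    show "(\<lambda>x. trace (\<rho> x) - 2) \<in> filtered G 0"
      using trace_filtered[OF \<rho>(1) three] by (intro filtered_diff filtered_const)
    show "class_function G (\<lambda>x. trace (\<rho> x) - 2)"
      using trace_class_function[OF \<rho>(1)] by (simp add: class_function_def)
    show "trace (\<rho> a) - 2 = 0" if "a \<in> A" for a
      using \<rho>(2)[OF that] by (simp add: trace_def one_mat2_def)
    show "trace (\<rho> b) - 2 \<noteq> 0" if "b \<in> B" "b \<noteq> \<one>" for b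
      using \<rho>(3)[OF that(1)] \<sigma>_trace[of b] that by (simp add: trace_const_mat numeral_poly)
  qed
qed

text \<open>In \<open>\<rho>(b)\<close> the coefficient of \<open>u\<^sup>2\<close> is a nonzero multiple of the upper right matrix unit \<open>E\<close>, and
  \<open>E \<sigma>(a) E\<close> is \<open>E\<close> times the lower left entry of \<open>\<sigma>(a)\<close>.  Hence no cancellation occurs in
  the coefficient of top degree of \<open>\<rho>\<close> at a mixed element, while \<open>tr \<sigma>\<close> is constant in
  \<open>u\<close>.\<close>

lemma detect_mixed:
  obtains f :: "'a \<Rightarrow> 'r poly" where "f \<in> filtered G 0" "class_function G f"
    "\<And>a. a \<in> A \<Longrightarrow> f a = 0" "\<And>g. g \<in> mixed \<Longrightarrow> f g \<noteq> 0"
proof -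
  from extend[OF const_\<sigma> sheared_\<sigma>] obtain \<rho> :: "'a \<Rightarrow> 'r poly mat2" where \<rho>: "mult_hom G \<rho>"
    "\<And>x. x \<in> A \<Longrightarrow> \<rho> x = const_mat (\<sigma> x)" "\<And>x. x \<in> B \<Longrightarrow> \<rho> x = sheared_mat (\<sigma> x)"
    by blast
  have "entries_dvd 3 (\<rho> x - 1)" if "x \<in> A \<union> B" for x
    using that
  proof
    assume "x \<in> A"
    then show ?thesis
      using entries_dvd_const_mat[OF \<sigma>_three[of x]] by (simp add: \<rho>(2))
  next
    assume "x \<in> B"
    then show ?thesis
      using entries_dvd_sheared_mat[OF \<sigma>_three[of x]] by (simp add: \<rho>(3))
  qed
  then have three: "entries_dvd 3 (\<rho> g - 1)" if "g \<in> carrier G" for g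
    using entries_dvd_of_factors[OF \<rho>(1)] that by blast
  have three': "entries_dvd 3 (const_mat (\<sigma> g) - 1)" if "g \<in> carrier G" for g
    using \<sigma>_three[OF that] by (rule entries_dvd_const_mat)
  have \<rho>_mult: "\<rho> (x \<otimes> y) = \<rho> x * \<rho> y" if "x \<in> carrier G" "y \<in> carrier G" for x y
    using \<rho>(1) that by (simp add: mult_hom_def)
  have lead: "\<exists>c. c \<noteq> 0 \<and> mat_leading (2 * Suc s) (\<rho> t) (Mat2 0 c 0 0)" if "t \<in> alternating s" for s t
    using that
  proof (induction s arbitrary: t)
    case 0
    then have t: "t \<in> B" "t \<noteq> \<one>" by simp_all
    have "mat_leading 2 (\<rho> t) (Mat2 0 (- m21 (\<sigma> t)) 0 0)"
      using mat_leading_sheared_mat[of "\<sigma> t"] \<rho>(3)[OF t(1)] by simp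
    then show ?case using \<sigma>_lower_left[of t] t by (intro exI[of _ "- m21 (\<sigma> t)"]) simp
  next
    case (Suc s)
    from Suc.prems obtain b a u where u: "b \<in> B" "b \<noteq> \<one>" "a \<in> A" "a \<noteq> \<one>" "u \<in> alternating s"
      "t = b \<otimes> a \<otimes> u"
      by (rule alternating_SucE)
    obtain c where c: "c \<noteq> 0" "mat_leading (2 * Suc s) (\<rho> u) (Mat2 0 c 0 0)"
      using Suc.IH[OF u(5)] by blast
    have "mat_leading (2 + 0 + 2 * Suc s) (sheared_mat (\<sigma> b) * const_mat (\<sigma> a) * \<rho> u)
        (Mat2 0 (- m21 (\<sigma> b)) 0 0 * \<sigma> a * Mat2 0 c 0 0)"
      by (intro mat_leading_mult mat_leading_sheared_mat mat_leading_const_mat c(2))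
    moreover have "\<rho> t = sheared_mat (\<sigma> b) * const_mat (\<sigma> a) * \<rho> u"
      using u by (simp add: \<rho>_mult \<rho>(2,3))
    moreover have "Mat2 0 (- m21 (\<sigma> b)) 0 0 * \<sigma> a * Mat2 0 c 0 0
        = Mat2 0 (- m21 (\<sigma> b) * m21 (\<sigma> a) * c) 0 0"
      by (simp add: times_mat2_def)
    ultimately have "mat_leading (2 * Suc (Suc s)) (\<rho> t) (Mat2 0 (- m21 (\<sigma> b) * m21 (\<sigma> a) * c) 0 0)"
      by simp
    moreover have "- m21 (\<sigma> b) * m21 (\<sigma> a) * c \<noteq> 0"
      using \<sigma>_lower_left[of a] \<sigma>_lower_left[of b] u c(1) by simp
    ultimately show ?case by blast
  qed
  show thesis
  proof
    let ?f = "\<lambda>x. trace (\<rho> x) - trace (const_mat (\<sigma> x))"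
    show "?f \<in> filtered G 0"
      using trace_filtered[OF \<rho>(1) three] trace_filtered[OF const_\<sigma> three'] by (intro filtered_diff)
    show "class_function G ?f"
      using trace_class_function[OF \<rho>(1)] trace_class_function[OF const_\<sigma>]
      by (simp add: class_function_def)
    show "?f a = 0" if "a \<in> A" for a
      using \<rho>(2)[OF that] by simp
    show "?f g \<noteq> 0" if "g \<in> mixed" for g
    proof -
      from that obtain a t s where g: "a \<in> A" "a \<noteq> \<one>" "t \<in> alternating s" "g = a \<otimes> t"
        by (auto simp: mixed_def)
      obtain c where c: "c \<noteq> 0" "mat_leading (2 * Suc s) (\<rho> t) (Mat2 0 c 0 0)"
        using lead[OF g(3)] by blast
      have "mat_leading (0 + 2 * Suc s) (\<rho> g) (\<sigma> a * Mat2 0 c 0 0)"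
        using mat_leading_mult[OF mat_leading_const_mat c(2)] g by (simp add: \<rho>_mult \<rho>(2))
      from mat_leading_trace[OF this]
      have "coeff (trace (\<rho> g)) (2 * Suc s) = m21 (\<sigma> a) * c"
        by (simp add: leading_def trace_def times_mat2_def)
      moreover have "m21 (\<sigma> a) * c \<noteq> 0" using \<sigma>_lower_left[of a] g c(1) by simp
      moreover have "coeff (trace (const_mat (\<sigma> g))) (2 * Suc s) = 0"
        by (simp add: trace_const_mat)
      ultimately show ?thesis by (metis eq_iff_diff_eq_0)
    qed
  qed
qed

lemma mixed_not_in_A: "g \<in> mixed \<Longrightarrow> g \<notin> A"
  using detect_mixed by metis

section \<open>Periodic factors\<close>

text \<open>A weak form of malnormality.  If \<open>u = a t a'\<close> with \<open>t\<close> alternating and \<open>x \<in> A\<close> is nontrivial, then both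
  \<open>x' = a' x a'\<^sup>-\<^sup>1\<close> and \<open>t x' t\<^sup>-\<^sup>1\<close> lie in \<open>A\<close>, although \<open>x' t x' t\<^sup>-\<^sup>1\<close> is
  mixed.\<close>

lemma conjugate_subset_imp_mem:
  assumes u: "u \<in> carrier G" and "A \<noteq> {\<one>}" and conj: "\<And>a. a \<in> A \<Longrightarrow> u \<otimes> a \<otimes> inv u \<in> A"
  shows "u \<in> A"
  using u
proof (cases rule: splitting_cases)
  case (2 a t a' s)
  obtain x where x: "x \<in> A" "x \<noteq> \<one>" using A_closed(1) \<open>A \<noteq> {\<one>}\<close> by blast
  let ?x = "a' \<otimes> x \<otimes> inv a'"
  have x': "?x \<in> A" using 2 x by simp
  have x'1: "?x \<noteq> \<one>"
  proof
    assume "?x = \<one>"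
    then have "inv a' \<otimes> ?x \<otimes> a' = \<one>" using 2 by simp
    moreover have "inv a' \<otimes> ?x \<otimes> a' = x"
      using 2 x by (simp add: m_assoc) (simp flip: m_assoc)
    ultimately show False using x by simp
  qed
  have "t \<otimes> ?x \<otimes> inv t \<in> alternating (Suc (s + s))"
    using 2 x' x'1 by (intro alternating_join alternating_inv)
  then have "?x \<otimes> (t \<otimes> ?x \<otimes> inv t) \<in> mixed" using x' x'1 by (intro mixedI)
  moreover have "t \<otimes> ?x \<otimes> inv t = inv a \<otimes> (u \<otimes> x \<otimes> inv u) \<otimes> a"
    using 2 x by (simp add: m_assoc inv_mult_group) (simp flip: m_assoc)
  then have "?x \<otimes> (t \<otimes> ?x \<otimes> inv t) \<in> A" using conj[OF x(1)] 2 x' by simp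
  ultimately show ?thesis using mixed_not_in_A by blast
qed

text \<open>The functions \<open>f\<close> and \<open>f'\<close> that detect mixed elements and elements of \<open>B\<close> vanish on \<open>\<Phi>(A)\<close>, so
  each element of \<open>\<Phi>(A)\<close> is conjugate into \<open>A\<close>.  A conjugator \<open>k\<close> that moves one nontrivial
  \<open>\<Phi>(x)\<close> into \<open>A\<close> moves all of \<open>\<Phi>(A)\<close> into \<open>A\<close>.\<close>

theorem image_conjugate_into_factor:
  assumes \<Phi>: "congruence_endomorphism G \<Phi>" and inj: "inj_on \<Phi> (carrier G)" and "A \<noteq> {\<one>}"
    and m: "m \<ge> 1"
    and period: "\<And>a. a \<in> A \<Longrightarrow> \<exists>g\<in>carrier G. \<exists>b\<in>A. (\<Phi> ^^ m) a = g \<otimes> b \<otimes> inv g"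
  obtains h where "h \<in> carrier G" "\<And>a. a \<in> A \<Longrightarrow> \<exists>b\<in>A. \<Phi> a = h \<otimes> b \<otimes> inv h"
proof -
  interpret \<Phi>: congruence_endomorphism G \<Phi> by (rule \<Phi>)
  interpret \<Phi>: group_hom G G \<Phi> by unfold_locales (rule \<Phi>.hom)
  have AG: "A \<subseteq> carrier G" by auto
  note vanish = \<Phi>.class_function_vanishes_on_image[OF AG m period]
  obtain f :: "'a \<Rightarrow> 'r poly" where f: "f \<in> filtered G 0" "class_function G f"
    "\<And>a. a \<in> A \<Longrightarrow> f a = 0" "\<And>g. g \<in> mixed \<Longrightarrow> f g \<noteq> 0"
    by (rule detect_mixed) blast
  obtain f' :: "'a \<Rightarrow> 'r poly" where f': "f' \<in> filtered G 0" "class_function G f'"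
    "\<And>a. a \<in> A \<Longrightarrow> f' a = 0" "\<And>b. b \<in> B \<Longrightarrow> b \<noteq> \<one> \<Longrightarrow> f' b \<noteq> 0"
    by (rule detect_B) blast
  obtain x where x: "x \<in> A" "x \<noteq> \<one>" using A_closed(1) \<open>A \<noteq> {\<one>}\<close> by blast
  have \<Phi>x: "\<Phi> x \<in> carrier G" using x by simp
  obtain c where c: "c \<in> A \<union> B \<union> mixed" "conjugate (\<Phi> x) c"
    using conjugate_cases[OF \<Phi>x] by blast
  have "f c = 0" "f' c = 0"
    using class_function_conjugate[OF f(2) c(2) \<Phi>x] class_function_conjugate[OF f'(2) c(2) \<Phi>x]
      vanish[OF _ f(1-3) x(1)] vanish[OF _ f'(1-3) x(1)] by simp_all
  then have "c \<in> A" using c(1) f(4) f'(4) by (cases "c = \<one>") auto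
  obtain k where k: "k \<in> carrier G" "c = k \<otimes> \<Phi> x \<otimes> inv k"
    using c(2) unfolding conjugate_def by blast
  have "\<Phi> x \<noteq> \<one>" using x inj inj_onD[of \<Phi> "carrier G" x \<one>] by auto
  have "c \<noteq> \<one>"
  proof
    assume "c = \<one>"
    then have "inv k \<otimes> (k \<otimes> \<Phi> x \<otimes> inv k) \<otimes> k = \<one>" using k by simp
    moreover have "inv k \<otimes> (k \<otimes> \<Phi> x \<otimes> inv k) \<otimes> k = \<Phi> x"
      using k(1) \<Phi>x by (simp add: m_assoc) (simp flip: m_assoc)
    ultimately show False using \<open>\<Phi> x \<noteq> \<one>\<close> by simp
  qed
  define \<Theta> where "\<Theta> y = k \<otimes> \<Phi> y \<otimes> inv k" for y
  have \<Theta>_closed: "\<Theta> y \<in> carrier G" if "y \<in> A" for y using that k by (simp add: \<Theta>_def)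
  have \<Theta>x: "\<Theta> x = c" by (simp add: \<Theta>_def k)
  have \<Theta>_mult: "\<Theta> (y \<otimes> z) = \<Theta> y \<otimes> \<Theta> z" if "y \<in> A" "z \<in> A" for y z
    using that k by (simp add: \<Theta>_def m_assoc) (simp flip: m_assoc)
  have f\<Theta>: "f (\<Theta> y) = 0" if "y \<in> A" for y
    using f(2) vanish[OF _ f(1-3) that] k that by (simp add: \<Theta>_def class_function_def)
  have \<Theta>A: "\<Theta> y \<in> A" if y: "y \<in> A" for y
    using \<Theta>_closed[OF y]
  proof (cases rule: splitting_cases)
    case (2 a t a' s)
    \<comment> \<open>For \<open>e \<in> A\<close> the product \<open>e \<Theta>(y)\<close> is conjugate to \<open>(a' e a) t\<close>, which is mixed unless
      \<open>a' e a\<close> is trivial.  This happens for at most one of \<open>e = 1\<close> and \<open>e = c\<close>.\<close>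
    have False if e: "e \<in> A" "e \<otimes> \<Theta> y = \<Theta> z" "z \<in> A" "a' \<otimes> e \<otimes> a \<noteq> \<one>" for e z
    proof -
      have "(a' \<otimes> e \<otimes> a) \<otimes> t \<in> mixed" using e 2 by (intro mixedI) simp_all
      then have "f ((a' \<otimes> e \<otimes> a) \<otimes> t) \<noteq> 0" by (rule f(4))
      moreover have "conjugate (\<Theta> z) ((a' \<otimes> e \<otimes> a) \<otimes> t)"
        using conjugate_swap[of "e \<otimes> a \<otimes> t" a'] 2 e by (simp add: m_assoc)
      ultimately show False
        using class_function_conjugate[OF f(2)] \<Theta>_closed[OF e(3)] f\<Theta>[OF e(3)] by metis
    qed
    moreover have "a' \<otimes> \<one> \<otimes> a \<noteq> \<one> \<or> a' \<otimes> c \<otimes> a \<noteq> \<one>"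
    proof (rule ccontr)
      assume "\<not> ?thesis"
      then have "a' \<otimes> c \<otimes> a = a' \<otimes> \<one> \<otimes> a" by simp
      then show False using \<open>c \<in> A\<close> \<open>c \<noteq> \<one>\<close> 2 by simp
    qed
    moreover have "\<one> \<otimes> \<Theta> y = \<Theta> y" "c \<otimes> \<Theta> y = \<Theta> (x \<otimes> y)"
      using \<Theta>_closed[OF y] \<Theta>_mult[OF x(1) y] \<Theta>x by simp_all
    ultimately show ?thesis using y x(1) \<open>c \<in> A\<close> A_closed(1,2) by metis
  qed
  show thesis
  proof (rule that[of "inv k"])
    fix a assume a: "a \<in> A"
    have "\<Phi> a = inv k \<otimes> \<Theta> a \<otimes> inv (inv k)"
      using a k by (simp add: \<Theta>_def m_assoc) (simp flip: m_assoc)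
    then show "\<exists>b\<in>A. \<Phi> a = inv k \<otimes> b \<otimes> inv (inv k)" using \<Theta>A[OF a] by blast
  qed (use k in simp)
qed

end

context group
begin

abbreviation conj_by :: "'a \<Rightarrow> 'a \<Rightarrow> 'a" where
  "conj_by g x \<equiv> g \<otimes> x \<otimes> inv g"

lemma conj_by_mult:
  "g \<in> carrier G \<Longrightarrow> h \<in> carrier G \<Longrightarrow> x \<in> carrier G \<Longrightarrow>
    conj_by (g \<otimes> h) x = conj_by g (conj_by h x)"
  by (simp add: m_assoc inv_mult_group)

lemma conj_class_eq_image: "conj_class G A = {conj_by g ` A | g. g \<in> carrier G}"
proof -
  have "g <# A #> inv g = conj_by g ` A" for g
    unfolding l_coset_def r_coset_def by blast
  then show ?thesis by (simp add: conj_class_def)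
qed

lemma conj_class_self: "A \<subseteq> carrier G \<Longrightarrow> A \<in> conj_class G A"
proof -
  assume "A \<subseteq> carrier G"
  then have "A = conj_by \<one> ` A" by (force simp: image_iff subset_iff)
  then show ?thesis unfolding conj_class_eq_image by blast
qed

lemma conj_class_conj_by:
  assumes g: "g \<in> carrier G" and A: "A \<subseteq> carrier G"
  shows "conj_class G (conj_by g ` A) = conj_class G A"
proof -
  have *: "conj_by h ` (conj_by g ` A) = conj_by (h \<otimes> g) ` A" if "h \<in> carrier G" for h
    unfolding image_image using that g A by (intro image_cong refl) (simp add: conj_by_mult subset_iff)
  show ?thesis
    unfolding conj_class_eq_image
  proof (intro equalityI subsetI; elim CollectE exE conjE)
    fix X h assume h: "h \<in> carrier G" and "X = conj_by h ` (conj_by g ` A)"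
    then have "X = conj_by (h \<otimes> g) ` A" by (simp only: *)
    then show "X \<in> {conj_by k ` A | k. k \<in> carrier G}" using m_closed[OF h g] by blast
  next
    fix X h assume h: "h \<in> carrier G" and X: "X = conj_by h ` A"
    have "conj_by (h \<otimes> inv g) ` (conj_by g ` A) = conj_by (h \<otimes> inv g \<otimes> g) ` A"
      using h g by (intro *) simp
    also have "h \<otimes> inv g \<otimes> g = h" using h g by (simp add: m_assoc)
    finally have "X = conj_by (h \<otimes> inv g) ` (conj_by g ` A)" by (simp only: X)
    then show "X \<in> {conj_by k ` (conj_by g ` A) | k. k \<in> carrier G}"
      using m_closed[OF h inv_closed[OF g]] by blast
  qed
qed

end

context free_splitting
begin

text \<open>By induction \<open>P(A)\<close> lies in a conjugate of \<open>A\<close> for \<open>P = \<Phi>\<^sup>m\<^sup>-\<^sup>1\<close>.  So the inclusion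
  \<open>\<Phi>(A) \<subseteq> h A h\<^sup>-\<^sup>1\<close> is mapped by \<open>P\<close> to a chain
  \<open>g A g\<^sup>-\<^sup>1 = P(\<Phi>(A)) \<subseteq> P(h A h\<^sup>-\<^sup>1) \<subseteq> u A u\<^sup>-\<^sup>1\<close>.  Since \<open>A\<close> is not conjugate to
  a proper subgroup of itself, all these inclusions are equalities, and \<open>P\<close> is
  injective.\<close>

theorem conj_class_image_factor:
  assumes \<Phi>: "congruence_endomorphism G \<Phi>" and inj: "inj_on \<Phi> (carrier G)" and "A \<noteq> {\<one>}"
    and m: "m \<ge> 1" and period: "conj_class G ((\<Phi> ^^ m) ` A) = conj_class G A"
  shows "conj_class G (\<Phi> ` A) = conj_class G A"
proof -
  interpret \<Phi>: congruence_endomorphism G \<Phi> by (rule \<Phi>)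
  interpret \<Phi>: group_hom G G \<Phi> by unfold_locales (rule \<Phi>.hom)
  have AG: "A \<subseteq> carrier G" by auto
  have pow_closed: "(\<Phi> ^^ j) x \<in> carrier G" if "x \<in> carrier G" for j x
    using that by (induction j) simp_all
  have pow_conj: "(\<Phi> ^^ j) (conj_by g x) = conj_by ((\<Phi> ^^ j) g) ((\<Phi> ^^ j) x)"
    if "g \<in> carrier G" "x \<in> carrier G" for j g x
    using that by (induction j) (simp_all add: pow_closed)
  have pow_inj: "x = y" if "(\<Phi> ^^ j) x = (\<Phi> ^^ j) y" "x \<in> carrier G" "y \<in> carrier G" for j x y
    using that by (induction j) (auto simp: pow_closed dest: inj_onD[OF inj])
  have "(\<Phi> ^^ m) ` A \<subseteq> carrier G" using pow_closed by auto
  from conj_class_self[OF this] obtain g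
    where g: "g \<in> carrier G" "(\<Phi> ^^ m) ` A = conj_by g ` A"
    unfolding period by (auto simp: conj_class_eq_image)
  have "\<exists>g\<in>carrier G. \<exists>b\<in>A. (\<Phi> ^^ m) a = conj_by g b" if "a \<in> A" for a
    using g that by blast
  from image_conjugate_into_factor[OF \<Phi> inj \<open>A \<noteq> {\<one>}\<close> m this]
  obtain h where h: "h \<in> carrier G" "\<And>a. a \<in> A \<Longrightarrow> \<exists>b\<in>A. \<Phi> a = conj_by h b" by blast
  have into: "\<exists>k\<in>carrier G. \<forall>a\<in>A. \<exists>b\<in>A. (\<Phi> ^^ j) a = conj_by k b" for j
  proof (induction j)
    case 0
    show ?case by (intro bexI[of _ \<one>]) auto
  next
    case (Suc j)
    then obtain k where k: "k \<in> carrier G" "\<And>a. a \<in> A \<Longrightarrow> \<exists>b\<in>A. (\<Phi> ^^ j) a = conj_by k b" by blast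
    have "\<exists>b\<in>A. (\<Phi> ^^ Suc j) a = conj_by (\<Phi> k \<otimes> h) b" if "a \<in> A" for a
    proof -
      obtain b where b: "b \<in> A" "(\<Phi> ^^ j) a = conj_by k b" using k(2) \<open>a \<in> A\<close> by blast
      obtain c where c: "c \<in> A" "\<Phi> b = conj_by h c" using h(2) b(1) by blast
      have "(\<Phi> ^^ Suc j) a = conj_by (\<Phi> k) (conj_by h c)" using b c k(1) by simp
      also have "\<dots> = conj_by (\<Phi> k \<otimes> h) c"
        using c(1) k(1) h(1) by (intro conj_by_mult[symmetric]) simp_all
      finally show ?thesis using c(1) by blast
    qed
    then show ?case using k(1) h(1) by (intro bexI[of _ "\<Phi> k \<otimes> h"]) simp_all
  qed
  obtain j where j: "m = Suc j" using m by (cases m) auto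
  let ?P = "\<Phi> ^^ j"
  have P\<Phi>: "?P ` (\<Phi> ` A) = conj_by g ` A"
    using g(2) by (simp add: j image_image funpow_swap1)
  obtain k where k: "k \<in> carrier G" "\<And>a. a \<in> A \<Longrightarrow> \<exists>b\<in>A. ?P a = conj_by k b"
    using into[of j] by blast
  define u where "u = ?P h \<otimes> k"
  have u: "u \<in> carrier G" using h(1) k(1) pow_closed by (simp add: u_def)
  have Pu: "?P (conj_by h a) \<in> conj_by u ` A" if "a \<in> A" for a
  proof -
    obtain b where b: "b \<in> A" "?P a = conj_by k b" using k(2) \<open>a \<in> A\<close> by blast
    have "?P (conj_by h a) = conj_by (?P h) (conj_by k b)"
      using pow_conj[OF h(1), of a] that b(2) by simp
    also have "\<dots> = conj_by u b"
      unfolding u_def using b(1) by (intro conj_by_mult[symmetric] pow_closed h(1) k(1)) simp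
    finally show ?thesis using b(1) by simp
  qed
  define v where "v = inv u \<otimes> g"
  have v: "v \<in> carrier G" using u g(1) by (simp add: v_def)
  have "conj_by v a \<in> A" if "a \<in> A" for a
  proof -
    have "conj_by g a \<in> ?P ` (\<Phi> ` A)" using P\<Phi> that by blast
    then obtain a' where "a' \<in> A" "conj_by g a = ?P (\<Phi> a')" by blast
    moreover obtain b where "b \<in> A" "\<Phi> a' = conj_by h b" using h(2) \<open>a' \<in> A\<close> by blast
    ultimately obtain c where c: "c \<in> A" "conj_by g a = conj_by u c" using Pu by force
    have "conj_by v a = conj_by (inv u) (conj_by g a)"
      unfolding v_def using u g(1) that by (intro conj_by_mult) simp_all
    also have "\<dots> = conj_by (inv u \<otimes> u) c"
      unfolding c(2) using u c(1) by (intro conj_by_mult[symmetric]) simp_all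
    also have "\<dots> = c" using u c(1) by simp
    finally show ?thesis using c(1) by simp
  qed
  with v have "v \<in> A" by (rule conjugate_subset_imp_mem[OF _ \<open>A \<noteq> {\<one>}\<close>])
  have "conj_by h ` A \<subseteq> \<Phi> ` A"
  proof
    fix y assume "y \<in> conj_by h ` A"
    then obtain a where a: "a \<in> A" "y = conj_by h a" by blast
    obtain c where c: "c \<in> A" "?P y = conj_by u c" using Pu[OF a(1)] a(2) by blast
    have "u = g \<otimes> inv v" using u g(1) by (simp add: v_def inv_mult_group flip: m_assoc)
    then have "?P y = conj_by g (conj_by (inv v) c)"
      using c g(1) v by (simp only: conj_by_mult inv_closed A_carrier)
    then have "?P y \<in> ?P ` (\<Phi> ` A)" unfolding P\<Phi> using \<open>v \<in> A\<close> c(1) by simp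
    then obtain a' where "a' \<in> A" "?P y = ?P (\<Phi> a')" by blast
    have "y = \<Phi> a'"
      by (rule pow_inj[OF \<open>?P y = ?P (\<Phi> a')\<close>]) (use a h(1) \<open>a' \<in> A\<close> in simp_all)
    then show "y \<in> \<Phi> ` A" using \<open>a' \<in> A\<close> by simp
  qed
  moreover have "\<Phi> ` A \<subseteq> conj_by h ` A" using h(2) by blast
  ultimately have "\<Phi> ` A = conj_by h ` A" by simp
  then show ?thesis using conj_class_conj_by[OF h(1) AG] by simp
qed

end

section \<open>Outer automorphisms and free factor systems\<close>

text \<open>The other factors are merged into one: the two homomorphisms are used on the factor \<open>i\<close> and on all
  others, and the extension agrees with the second one on the subgroup that these generate.\<close>

lemma (in group) free_splitting_factor:
  fixes \<sigma> :: "'a \<Rightarrow> 'r::three_separated mat2"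
  assumes free: "internal_free_product G I H" and i: "i \<in> I"
    and \<sigma>: "mult_hom G \<sigma>"
    "\<And>g. g \<in> carrier G \<Longrightarrow> entries_dvd 3 (\<sigma> g - 1)"
    "\<And>g. g \<in> carrier G \<Longrightarrow> g \<noteq> \<one> \<Longrightarrow> m21 (\<sigma> g) \<noteq> 0"
    "\<And>g. g \<in> carrier G \<Longrightarrow> g \<noteq> \<one> \<Longrightarrow> trace (\<sigma> g) \<noteq> 2"
  shows "free_splitting G (H i) (generate G (\<Union>j\<in>I - {i}. H j)) \<sigma>"
proof (rule free_splitting.intro[OF is_group free_splitting_axioms.intro])
  let ?S = "\<Union>j\<in>I - {i}. H j"
  have sub: "subgroup (H j) G" if "j \<in> I" for j
    using free that by (simp add: internal_free_product_def)
  have S: "?S \<subseteq> carrier G" using sub subgroup.subset by blast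
  show "subgroup (H i) G" using sub[OF i] .
  show "subgroup (generate G ?S) G" using generate_is_subgroup[OF S] .
  show "P g" if "g \<in> carrier G" "P \<one>"
    "\<And>x g. x \<in> H i \<union> generate G ?S \<Longrightarrow> g \<in> carrier G \<Longrightarrow> P g \<Longrightarrow> P (x \<otimes> g)" for P g
  proof (rule internal_free_product_induct[where P = P, OF free that(1,2)])
    fix j x g assume *: "j \<in> I" "x \<in> H j" "g \<in> carrier G" "P g"
    then have "x \<in> H i \<union> generate G ?S" by (cases "j = i") (auto intro: generate.incl)
    then show "P (x \<otimes> g)" using that(3) * by blast
  qed
  show "\<exists>\<rho> :: 'a \<Rightarrow> 'r poly mat2. mult_hom G \<rho> \<and> (\<forall>x\<in>H i. \<rho> x = \<phi> x) \<and> (\<forall>x\<in>generate G ?S. \<rho> x = \<phi>' x)"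
    if \<phi>: "mult_hom G \<phi>" "mult_hom G \<phi>'" for \<phi> \<phi>'
  proof -
    have carr: "x \<in> carrier G" if "j \<in> I" "x \<in> H j" for j x
      using sub[OF that(1)] that(2) by (rule subgroup.mem_carrier)
    have "\<exists>\<rho> :: 'a \<Rightarrow> 'r poly mat2. mult_hom G \<rho> \<and>
        (\<forall>j\<in>I. \<forall>x\<in>H j. \<rho> x = (if j = i then \<phi> else \<phi>') x)"
      using \<phi> carr by (intro internal_free_product_extend[OF free]) (auto simp: mult_hom_def)
    then obtain \<rho> :: "'a \<Rightarrow> 'r poly mat2" where \<rho>: "mult_hom G \<rho>"
      "\<And>j x. j \<in> I \<Longrightarrow> x \<in> H j \<Longrightarrow> \<rho> x = (if j = i then \<phi> else \<phi>') x" by blast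
    have "\<rho> x = \<phi>' x" if "x \<in> generate G ?S" for x
      using that
    proof (induction rule: generate.induct)
      case one
      then show ?case using \<rho>(1) \<phi>(2) by (simp add: mult_hom_def)
    next
      case (incl h)
      then obtain j where "j \<in> I" "j \<noteq> i" "h \<in> H j" by blast
      then show ?case using \<rho>(2)[of j h] by simp
    next
      case (inv h)
      then obtain j where "j \<in> I" "j \<noteq> i" "h \<in> H j" by blast
      then show ?case using \<rho>(2)[of j "inv h"] subgroup.m_inv_closed[OF sub] by simp
    next
      case (eng x y)
      then have "x \<in> carrier G" "y \<in> carrier G" using generate_in_carrier[OF S] by blast+
      then show ?case using eng \<rho>(1) \<phi>(2) by (simp add: mult_hom_def)
    qed
    moreover have "\<forall>x\<in>H i. \<rho> x = \<phi> x" using \<rho>(2)[OF i] by simp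
    ultimately show ?thesis using \<rho>(1) by blast
  qed
qed (fact \<sigma>)+

text \<open>Triviality on homology determines \<open>f(x)\<close> up to cubes in the abelianization, hence up to
  commutators and a cube in \<open>G\<close>.\<close>

lemma (in group) IA_three_representative:
  assumes "\<Psi> \<in> IA G 3"
  obtains f where "f \<in> auto G" "\<Psi> = Inn G #>\<^bsub>AutoGroup G\<^esub> f" "congruence_endomorphism G f"
proof -
  let ?D = "derived G (carrier G)" and ?A = "Abelianization G"
  let ?P = "power_subgroup 3 ?A"
  interpret D: normal ?D G by (rule derived_self_is_normal)
  interpret A: comm_group ?A by (rule comm_group_Abelianization)
  interpret P: normal ?P ?A by (rule A.power_subgroup_normal)
  interpret \<pi>: group_hom G ?A "\<lambda>x. ?D #> x"
    unfolding Abelianization_def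
    by (intro group_hom.intro group_hom_axioms.intro D.r_coset_hom_Mod D.factorgroup_is_group is_group)
  from assms obtain f where f: "f \<in> auto G" "\<Psi> = Inn G #>\<^bsub>AutoGroup G\<^esub> f"
    by (auto simp: IA_def kernel_def Out_def carrier_FactGroup carrier_AutoGroup)
  have H1: "H1_map G 3 f = \<one>\<^bsub>AutoGroup (H1 G 3)\<^esub>"
    using assms Out_H1_coset[OF f(1)] by (simp add: IA_def kernel_def f(2))
  have q: "quotient_map G ?D f \<in> auto ?A"
    unfolding Abelianization_def
    by (intro quotient_map_auto derived_self_is_normal auto_derived f(1))
  have "\<exists>d\<in>?D. \<exists>y\<in>carrier G. f x = d \<otimes> y [^] (3::nat) \<otimes> x" if x: "x \<in> carrier G" for x
  proof -
    have fx: "f x \<in> carrier G" using auto_closed[OF f(1) x] .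
    have \<pi>x: "?D #> x \<in> carrier ?A" "?D #> f x \<in> carrier ?A" using x fx by simp_all
    have "H1_map G 3 f (?P #>\<^bsub>?A\<^esub> (?D #> x)) = ?P #>\<^bsub>?A\<^esub> quotient_map G ?D f (?D #> x)"
      unfolding H1_map_def
      by (intro quotient_map_auto(2) A.power_subgroup_normal A.auto_power_subgroup q \<pi>x)
    also have "quotient_map G ?D f (?D #> x) = ?D #> f x"
      by (intro quotient_map_auto(2) derived_self_is_normal auto_derived f(1) x)
    finally have "?P #>\<^bsub>?A\<^esub> (?D #> f x) = ?P #>\<^bsub>?A\<^esub> (?D #> x)"
      using \<pi>x(1) by (simp add: H1 one_AutoGroup H1_def carrier_FactGroup)
    then have "?D #> f x \<in> ?P #>\<^bsub>?A\<^esub> (?D #> x)"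
      using A.rcos_self[OF \<pi>x(2) P.subgroup_axioms] by simp
    then obtain Y where Y: "Y \<in> carrier ?A" "?D #> f x = Y [^]\<^bsub>?A\<^esub> (3::nat) \<otimes>\<^bsub>?A\<^esub> (?D #> x)"
      by (auto simp: r_coset_def[of ?A] power_subgroup_def)
    obtain y where y: "y \<in> carrier G" "Y = ?D #> y"
      using Y(1) by (auto simp: Abelianization_def carrier_FactGroup)
    have "?D #> f x = ?D #> (y [^] (3::nat) \<otimes> x)"
      using Y(2) x y by (simp add: \<pi>.hom_nat_pow)
    then have "f x \<in> ?D #> (y [^] (3::nat) \<otimes> x)"
      using rcos_self[OF fx D.subgroup_axioms] by simp
    then obtain d where "d \<in> ?D" "f x = d \<otimes> (y [^] (3::nat) \<otimes> x)"
      by (auto simp: r_coset_def)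
    then show ?thesis using y(1) x by (intro bexI[of _ d] bexI[of _ y]) (simp_all add: m_assoc)
  qed
  then have "congruence_endomorphism G f"
    using f(1) by unfold_locales (auto simp: auto_def)
  then show thesis using f that by blast
qed

text \<open>The power of the outer automorphism is represented by an automorphism that agrees with
  \<open>f\<^sup>q\<close> on the carrier only, since automorphisms are undefined elsewhere.\<close>

lemma (in group) Out_conj_class_power:
  assumes f: "f \<in> auto G" and \<Psi>: "\<Psi> = Inn G #>\<^bsub>AutoGroup G\<^esub> f" and A: "A \<subseteq> carrier G"
  shows "Out_conj_class (\<Psi> [^]\<^bsub>Out G\<^esub> (q::nat)) (conj_class G A) = conj_class G ((f ^^ q) ` A)"
proof -
  interpret I: normal "Inn G" "AutoGroup G" by (rule Inn_normal)
  interpret Out: group "Out G" by (rule group_Out)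
  have "\<exists>h\<in>auto G. \<Psi> [^]\<^bsub>Out G\<^esub> q = Inn G #>\<^bsub>AutoGroup G\<^esub> h \<and> (\<forall>x\<in>carrier G. h x = (f ^^ q) x)"
  proof (induction q)
    case 0
    have "\<one>\<^bsub>AutoGroup G\<^esub> \<in> auto G"
      using I.one_closed by (simp add: carrier_AutoGroup)
    moreover have "\<one>\<^bsub>Out G\<^esub> = Inn G #>\<^bsub>AutoGroup G\<^esub> \<one>\<^bsub>AutoGroup G\<^esub>"
      using I.coset_mult_one[OF I.subset] by (simp add: Out_def)
    moreover have "\<forall>x\<in>carrier G. \<one>\<^bsub>AutoGroup G\<^esub> x = (f ^^ 0) x"
      by (simp add: one_AutoGroup)
    ultimately show ?case unfolding Out.nat_pow_0 by blast
  next
    case (Suc q)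
    then obtain h where h: "h \<in> auto G" "\<Psi> [^]\<^bsub>Out G\<^esub> q = Inn G #>\<^bsub>AutoGroup G\<^esub> h"
      "\<And>x. x \<in> carrier G \<Longrightarrow> h x = (f ^^ q) x" by blast
    let ?h = "h \<otimes>\<^bsub>AutoGroup G\<^esub> f"
    have "?h \<in> auto G"
      using h(1) f I.m_closed[of h f] by (simp add: carrier_AutoGroup)
    moreover have "\<Psi> [^]\<^bsub>Out G\<^esub> Suc q = Inn G #>\<^bsub>AutoGroup G\<^esub> ?h"
    proof -
      have "\<Psi> [^]\<^bsub>Out G\<^esub> Suc q = (Inn G #>\<^bsub>AutoGroup G\<^esub> h) \<otimes>\<^bsub>Out G\<^esub> \<Psi>"
        by (simp only: Out.nat_pow_Suc h(2))
      also have "\<dots> = Inn G #>\<^bsub>AutoGroup G\<^esub> ?h"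
        using h(1) f by (simp add: \<Psi> Out_def I.rcos_sum carrier_AutoGroup)
      finally show ?thesis .
    qed
    moreover have "?h x = (f ^^ Suc q) x" if "x \<in> carrier G" for x
      using h f that auto_closed[OF f that] by (simp add: mult_AutoGroup compose_def funpow_swap1)
    ultimately show ?case by blast
  qed
  then obtain h where h: "h \<in> auto G" "\<Psi> [^]\<^bsub>Out G\<^esub> q = Inn G #>\<^bsub>AutoGroup G\<^esub> h"
    "\<And>x. x \<in> carrier G \<Longrightarrow> h x = (f ^^ q) x" by blast
  have "h ` A = (f ^^ q) ` A" using h(3) A by (intro image_cong) auto
  then show ?thesis using Out_conj_class_coset[OF h(1) A] h(2) by simp
qed

lemma periodic_of_finite_image:
  assumes "finite F" "U ` F = F" "c \<in> F"
  obtains r where "r \<ge> 1" "(U ^^ r) c = c"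
proof -
  let ?p = "\<lambda>x. if x \<in> F then U x else x"
  have "inj_on U F" using assms by (simp add: eq_card_imp_inj_on)
  then have "inj ?p" using assms(2) by (auto simp: inj_def dest: inj_onD)
  have p: "(?p ^^ r) c = (U ^^ r) c \<and> (U ^^ r) c \<in> F" for r
    using assms(2,3) by (induction r) auto
  then have "{y. \<exists>r. y = (?p ^^ r) c} \<subseteq> F" by auto
  then have "finite {y. \<exists>r. y = (?p ^^ r) c}" using assms(1) finite_subset by blast
  with \<open>inj ?p\<close> obtain r where "r > 0" "(?p ^^ r) c = c"
    by (rule funpow_inj_finite)
  then show thesis using p[of r] that[of r] by simp
qed

theorem theorem3p1:
  fixes n :: nat and \<psi> :: "((nat \<times> bool) list \<Rightarrow> (nat \<times> bool) list) set"
    and \<F> :: "(nat \<times> bool) list set set set"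
  assumes "\<psi> \<in> IA (Free n) 3"
    and "free_factor_system (Free n) \<F>"
    and "ffs_periodic (Free n) \<psi> \<F>"
  shows "ffs_fixed \<psi> \<F>"
proof -
  let ?G = "Free n"
  interpret G: group ?G by (rule group_free_group)
  obtain f where f: "f \<in> auto ?G" "\<psi> = Inn ?G #>\<^bsub>AutoGroup ?G\<^esub> f" "congruence_endomorphism ?G f"
    using G.IA_three_representative[OF assms(1)] by blast
  obtain k :: nat and A B where \<F>: "\<F> = (\<lambda>i. conj_class ?G (A i)) ` {..<k}"
    and nontrivial: "\<And>i. i < k \<Longrightarrow> A i \<noteq> {\<one>\<^bsub>?G\<^esub>}"
    and free: "internal_free_product ?G {..k} (A(k := B))"
    using assms(2) unfolding free_factor_system_def by blast
  obtain q :: nat where q: "q \<ge> 1" "Out_ffs (\<psi> [^]\<^bsub>Out ?G\<^esub> q) \<F> = \<F>"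
    using assms(3) unfolding ffs_periodic_def by blast
  let ?U = "Out_conj_class (\<psi> [^]\<^bsub>Out ?G\<^esub> q)"
  have word: "reduced_word w" "w \<noteq> []" if "w \<in> carrier ?G" "w \<noteq> \<one>\<^bsub>?G\<^esub>" for w
    using that by (simp_all add: free_group_def)
  have inj: "inj_on f (carrier ?G)"
    using f(1) by (auto simp: auto_def Bij_def bij_betw_def)
  have fixed: "Out_conj_class \<psi> (conj_class ?G (A i)) = conj_class ?G (A i)" if i: "i < k" for i
  proof -
    \<comment> \<open>The cofactor, at the index \<open>k\<close>, becomes part of the complement of \<open>A i\<close>.\<close>
    interpret free_splitting ?G "(A(k := B)) i" "generate ?G (\<Union>j\<in>{..k} - {i}. (A(k := B)) j)" word_matrix
    proof (rule G.free_splitting_factor[OF free])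
      show "mult_hom ?G word_matrix" by (rule word_matrix_mult_hom)
      show "entries_dvd 3 (word_matrix g - 1)" for g by (rule entries_dvd_word_matrix)
      show "m21 (word_matrix g) \<noteq> 0" if "g \<in> carrier ?G" "g \<noteq> \<one>\<^bsub>?G\<^esub>" for g
        using word_matrix_lower_left[OF word[OF that]] .
      show "trace (word_matrix g) \<noteq> 2" if "g \<in> carrier ?G" "g \<noteq> \<one>\<^bsub>?G\<^esub>" for g
        using trace_word_matrix[OF word[OF that]] .
    qed (use i in simp)
    have Ai: "(A(k := B)) i = A i" using i by simp
    have AG: "A i \<subseteq> carrier ?G" using A_carrier unfolding Ai by blast
    have img: "(f ^^ j) ` A i \<subseteq> carrier ?G" for j
      using AG G.auto_closed[OF f(1)] by (induction j) (auto simp: image_subset_iff)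
    have "finite \<F>" "conj_class ?G (A i) \<in> \<F>" using i by (auto simp: \<F>)
    then obtain r where r: "r \<ge> 1" "(?U ^^ r) (conj_class ?G (A i)) = conj_class ?G (A i)"
      using periodic_of_finite_image[of \<F> ?U] q(2) unfolding Out_ffs_def by blast
    have "(?U ^^ j) (conj_class ?G (A i)) = conj_class ?G ((f ^^ (q * j)) ` A i)" for j
    proof (induction j)
      case (Suc j)
      then show ?case
        using G.Out_conj_class_power[OF f(1,2) img[of "q * j"], of q]
        by (simp add: funpow_add image_comp)
    qed simp
    then have "conj_class ?G ((f ^^ (q * r)) ` A i) = conj_class ?G (A i)" using r(2) by simp
    then have "conj_class ?G (f ` A i) = conj_class ?G (A i)"
      using conj_class_image_factor[OF f(3) inj, of "q * r"] nontrivial[OF i] q(1) r(1)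
      unfolding Ai by simp
    then show ?thesis using G.Out_conj_class_coset[OF f(1) AG] f(2) by simp
  qed
  have "Out_ffs \<psi> \<F> = \<F>"
    unfolding Out_ffs_def \<F> image_image using fixed by (intro image_cong) auto
  then show ?thesis by (simp add: ffs_fixed_def)
qed

end
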